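(* Let $G=(V,E,m,\omega)$ be a complete weighted graph with non-degenerate measure $m$, and assume $\omega_{\min}:=\inf_{x,y\in V,\,x\sim y}\omega_{xy}>0$ and $m_{\max}:=\sup_{x\in V}m(x)<\infty$. Suppose $G$ satisfies $CDE'(n,0)$, $n>0$. Then for all $x,z\in V$, all $0<t<s$, and every $0\le f\in\ell^p_m$ with $p\in[1,\infty]$, $$P_t f(x)\leq P_s f(z)\left(\frac{s}{t}\right)^{n} \exp\left(\frac{4m_{\max}\, d(x,z)^{2}}{\omega_{\min}( s-t)}\right),$$ where $d(x,z)$ is the graph distance, i.e. the number of edges of a shortest path from $x$ to $z$.
   Context: Setting: $G=(V,E,m,\omega)$ is an infinite connected weighted graph (loops allowed): $V$ is the vertex set, $E$ a symmetric set of edges, $x\sim y$ means $\{x,y\}\in E$, $m:V\to(0,\infty)$ is a vertex measure, and $\omega_{xy}=\omega_{yx}>0$ is the weight of the edge $\{x,y\}$. The graph is locally finite: every vertex has finitely many neighbours, so $\deg(x)=\sum_{y\sim x}\omega_{xy}<\infty$ for all $x$. $C_0(V)$ is the set of finitely supported real functions on $V$; $\ell^p_m$ is the $\ell^p$ space on $V$ with respect to $m$. The measure $m$ is non-degenerate if $\inf_{x\in V}m(x)>0$. Laplacian and semigroup: $\Delta f(x)=\frac{1}{m(x)}\sum_{y\sim x}\omega_{xy}(f(y)-f(x))$. Let $Q(f,g)=\frac12\sum_{x,y\in V}\omega_{xy}(f(y)-f(x))(g(y)-g(x))$ (with $\omega_{xy}=0$ if $x\not\sim y$), with domain $D(Q)$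 the completion of $C_0(V)$ under $\|f\|_Q=(\|f\|_{\ell^2_m}^2+Q(f,f))^{1/2}$. The associated self-adjoint generator on $\ell^2_m$ is $\Delta$ with domain $D(\Delta)=\{f\in D(Q):\Delta f\in\ell^2_m\}$. $P_t=e^{t\Delta}$ is the heat semigroup, extended to all $\ell^p_m$, $p\in[1,\infty]$, by $P_tf(x)=\sum_{y}p(t,x,y)f(y)m(y)$ with $p(t,x,y)=P_t(\delta_y/m(y))(x)$, where $\delta_y$ is the indicator function of $\{y\}$. Gradient forms: $\Gamma(f,g)(x)=\frac{1}{2m(x)}\sum_{y\sim x}\omega_{xy}(f(y)-f(x))(g(y)-g(x))$, $\Gamma(f)=\Gamma(f,f)$. For positive $f$, $\widetilde{\Gamma_2}(f)=\frac12\Delta\Gamma(f)-\Gamma\left(f,\frac{\Delta (f^2)}{2f}\right)$. $G$ satisfies $CDE'(n,K)$ if for every positive function $f:V\to(0,\infty)$ and every $x\in V$, $\widetilde{\Gamma_2}(f)(x)\ge\frac1n f(x)^2(\Delta\log f)(x)^2+K\Gamma(f)(x)$. $G$ is complete if there is a non-decreasing sequence $\{\eta_k\}$ in $C_0(V)$ with $\eta_k\to\mathbf 1$ pointwise and $\Gamma(\eta_k)\le\frac1k$ on $V$ for all $k\ge1$. *)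

theory Defs
  imports "HOL-Analysis.Analysis"
begin

text \<open>
  The vertex set is the whole type \<^typ>\<open>'v\<close>. Edges are ordered pairs, symmetric by assumption;
  a loop at \<open>x\<close> is the pair \<open>(x, x)\<close>.
\<close>

record 'v wgraph =
  edges :: "('v \<times> 'v) set"
  meas :: "'v \<Rightarrow> real"
  wt :: "'v \<Rightarrow> 'v \<Rightarrow> real"

definition nbrs :: "'v wgraph \<Rightarrow> 'v \<Rightarrow> 'v set" where
  "nbrs G x = {y. (x, y) \<in> edges G}"

locale weighted_graph =
  fixes G :: "'v wgraph"
  assumes infinite_vertices: "infinite (UNIV :: 'v set)"
    and edges_sym: "sym (edges G)"
    and connected: "(x, y) \<in> (edges G)\<^sup>*"
    and locally_finite: "finite (nbrs G x)"
    and meas_pos: "meas G x > 0"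
    and wt_sym: "wt G x y = wt G y x"
    and wt_pos: "(x, y) \<in> edges G \<Longrightarrow> wt G x y > 0"
    and wt_zero: "(x, y) \<notin> edges G \<Longrightarrow> wt G x y = 0"

definition graph_dist :: "'v wgraph \<Rightarrow> 'v \<Rightarrow> 'v \<Rightarrow> nat" where
  "graph_dist G x z = (LEAST k. (x, z) \<in> edges G ^^ k)"

text \<open>
  The infimum and supremum below are taken in \<^typ>\<open>real\<close>. The infima are over nonempty sets bounded
  below by \<open>0\<close>; \<open>m_max\<close> is meaningful only if the measure is bounded above.
\<close>

definition nondegenerate :: "'v wgraph \<Rightarrow> bool" where
  "nondegenerate G \<longleftrightarrow> (INF x. meas G x) > 0"

definition w_min :: "'v wgraph \<Rightarrow> real" where
  "w_min G = (INF (x, y)\<in>edges G. wt G x y)"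

definition m_max :: "'v wgraph \<Rightarrow> real" where
  "m_max G = (SUP x. meas G x)"


section \<open>Function spaces\<close>

definition C0 :: "('v \<Rightarrow> real) set" where
  "C0 = {f. finite {x. f x \<noteq> 0}}"

definition lp :: "'v wgraph \<Rightarrow> ereal \<Rightarrow> ('v \<Rightarrow> real) set" where
  "lp G p = {f. if p = \<infinity> then bounded (range f)
                else (\<lambda>x. \<bar>f x\<bar> powr real_of_ereal p * meas G x) summable_on UNIV}"

definition l2_inner :: "'v wgraph \<Rightarrow> ('v \<Rightarrow> real) \<Rightarrow> ('v \<Rightarrow> real) \<Rightarrow> real" where
  "l2_inner G f g = (\<Sum>\<^sub>\<infinity>x. f x * g x * meas G x)"

definition l2_norm :: "'v wgraph \<Rightarrow> ('v \<Rightarrow> real) \<Rightarrow> real" where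
  "l2_norm G f = sqrt (l2_inner G f f)"


section \<open>Laplacian and gradient forms\<close>

definition Lap :: "'v wgraph \<Rightarrow> ('v \<Rightarrow> real) \<Rightarrow> 'v \<Rightarrow> real" where
  "Lap G f x = 1 / meas G x * (\<Sum>y\<in>nbrs G x. wt G x y * (f y - f x))"

definition Gam :: "'v wgraph \<Rightarrow> ('v \<Rightarrow> real) \<Rightarrow> ('v \<Rightarrow> real) \<Rightarrow> 'v \<Rightarrow> real" where
  "Gam G f g x = 1 / (2 * meas G x) * (\<Sum>y\<in>nbrs G x. wt G x y * (f y - f x) * (g y - g x))"

definition Gam2_tilde :: "'v wgraph \<Rightarrow> ('v \<Rightarrow> real) \<Rightarrow> 'v \<Rightarrow> real" where
  "Gam2_tilde G f x =
     1 / 2 * Lap G (Gam G f f) x - Gam G f (\<lambda>y. Lap G (\<lambda>z. (f z)\<^sup>2) y / (2 * f y)) x"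

definition CDE' :: "'v wgraph \<Rightarrow> real \<Rightarrow> real \<Rightarrow> bool" where
  "CDE' G n K \<longleftrightarrow> (\<forall>f. (\<forall>x. f x > 0) \<longrightarrow>
     (\<forall>x. Gam2_tilde G f x \<ge> 1 / n * (f x)\<^sup>2 * (Lap G (\<lambda>y. ln (f y)) x)\<^sup>2 + K * Gam G f f x))"

definition graph_complete :: "'v wgraph \<Rightarrow> bool" where
  "graph_complete G \<longleftrightarrow> (\<exists>\<eta> :: nat \<Rightarrow> 'v \<Rightarrow> real.
     (\<forall>k. \<eta> k \<in> C0) \<and> incseq \<eta> \<and> (\<forall>x. (\<lambda>k. \<eta> k x) \<longlonglongrightarrow> 1) \<and>
     (\<forall>k\<ge>1. \<forall>x. Gam G (\<eta> k) (\<eta> k) x \<le> 1 / real k))"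


section \<open>Dirichlet form and generator\<close>

definition energy :: "'v wgraph \<Rightarrow> ('v \<Rightarrow> real) \<Rightarrow> ('v \<Rightarrow> real) \<Rightarrow> real" where
  "energy G f g = 1 / 2 * (\<Sum>\<^sub>\<infinity>(x, y). wt G x y * (f y - f x) * (g y - g x))"

definition finite_energy :: "'v wgraph \<Rightarrow> ('v \<Rightarrow> real) \<Rightarrow> bool" where
  "finite_energy G f \<longleftrightarrow> (\<lambda>(x, y). wt G x y * (f y - f x)\<^sup>2) summable_on UNIV"

definition Q_norm :: "'v wgraph \<Rightarrow> ('v \<Rightarrow> real) \<Rightarrow> real" where
  "Q_norm G f = sqrt ((l2_norm G f)\<^sup>2 + energy G f f)"

text \<open>
  Convergence in the form norm implies convergence in \<open>\<ell>\<^sup>2\<close>, and the form is closable, so the completion of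
  the finitely supported functions is their closure among the \<open>\<ell>\<^sup>2\<close> functions of finite energy. Finiteness
  has to be required explicitly because \<^const>\<open>infsum\<close> returns \<open>0\<close> on families that are not summable.
\<close>

definition dom_Q :: "'v wgraph \<Rightarrow> ('v \<Rightarrow> real) set" where
  "dom_Q G = {f \<in> lp G 2. finite_energy G f \<and>
     (\<exists>\<phi> :: nat \<Rightarrow> 'v \<Rightarrow> real. (\<forall>k. \<phi> k \<in> C0) \<and> (\<lambda>k. Q_norm G (\<lambda>x. f x - \<phi> k x)) \<longlonglongrightarrow> 0)}"

definition dom_Lap :: "'v wgraph \<Rightarrow> ('v \<Rightarrow> real) set" where
  "dom_Lap G = {f \<in> dom_Q G. Lap G f \<in> lp G 2}"


section \<open>Heat semigroup\<close>

text \<open>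
  Strongly continuous semigroups of symmetric contractions on \<open>\<ell>\<^sup>2\<close>. The values of \<open>P t f\<close> for \<open>t < 0\<close> or
  \<open>f\<close> not in \<open>\<ell>\<^sup>2\<close> are irrelevant.
\<close>

definition symmetric_contraction_semigroup ::
    "'v wgraph \<Rightarrow> (real \<Rightarrow> ('v \<Rightarrow> real) \<Rightarrow> 'v \<Rightarrow> real) \<Rightarrow> bool" where
  "symmetric_contraction_semigroup G P \<longleftrightarrow>
     (\<forall>t\<ge>0. \<forall>f\<in>lp G 2. P t f \<in> lp G 2 \<and> l2_norm G (P t f) \<le> l2_norm G f) \<and>
     (\<forall>t\<ge>0. \<forall>f\<in>lp G 2. \<forall>g\<in>lp G 2. \<forall>a b.
        P t (\<lambda>x. a * f x + b * g x) = (\<lambda>x. a * P t f x + b * P t g x)) \<and>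
     (\<forall>t\<ge>0. \<forall>f\<in>lp G 2. \<forall>g\<in>lp G 2. l2_inner G (P t f) g = l2_inner G f (P t g)) \<and>
     (\<forall>f\<in>lp G 2. P 0 f = f) \<and>
     (\<forall>s\<ge>0. \<forall>t\<ge>0. \<forall>f\<in>lp G 2. P (s + t) f = P s (P t f)) \<and>
     (\<forall>f\<in>lp G 2. ((\<lambda>t. l2_norm G (\<lambda>x. P t f x - f x)) \<longlongrightarrow> 0) (at_right 0))"

text \<open>
  \<open>P\<^sub>t = e\<^bsup>t\<Delta>\<^esup>\<close>: the infinitesimal generator of \<open>P\<close>, with its exact domain, is \<open>\<Delta>\<close> with domain \<open>D(\<Delta>)\<close>.
  This determines \<open>P t f\<close> uniquely for \<open>t \<ge> 0\<close> and \<open>f\<close> in \<open>\<ell>\<^sup>2\<close>.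
\<close>

definition heat_semigroup ::
    "'v wgraph \<Rightarrow> (real \<Rightarrow> ('v \<Rightarrow> real) \<Rightarrow> 'v \<Rightarrow> real) \<Rightarrow> bool" where
  "heat_semigroup G P \<longleftrightarrow> symmetric_contraction_semigroup G P \<and>
     (\<forall>f\<in>lp G 2. \<forall>g\<in>lp G 2.
        ((\<lambda>t. l2_norm G (\<lambda>x. (P t f x - f x) / t - g x)) \<longlongrightarrow> 0) (at_right 0) \<longleftrightarrow>
        f \<in> dom_Lap G \<and> g = Lap G f)"

definition heat_kernel ::
    "'v wgraph \<Rightarrow> (real \<Rightarrow> ('v \<Rightarrow> real) \<Rightarrow> 'v \<Rightarrow> real) \<Rightarrow> real \<Rightarrow> 'v \<Rightarrow> 'v \<Rightarrow> real" where
  "heat_kernel G P t x y = P t (\<lambda>z. indicator {y} z / meas G y) x"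

definition heat_ext ::
    "'v wgraph \<Rightarrow> (real \<Rightarrow> ('v \<Rightarrow> real) \<Rightarrow> 'v \<Rightarrow> real) \<Rightarrow> real \<Rightarrow> ('v \<Rightarrow> real) \<Rightarrow> 'v \<Rightarrow> real" where
  "heat_ext G P t f x = (\<Sum>\<^sub>\<infinity>y. heat_kernel G P t x y * f y * meas G y)"

end

theory Submission
  imports Defs
begin

text \<open>
  The core is the Li--Yau inequality
  \<open>\<Gamma>(\<surd>u) \<le> \<Delta>u / 2 + n u / (2\<tau>)\<close> for \<open>u = P\<^sub>\<tau> f + \<epsilon>\<close>, where \<open>f \<ge> 0\<close> lies in the domain of the generator
  and \<open>\<epsilon> > 0\<close>. Instead of differentiating \<open>P\<^sub>\<tau> (\<Gamma>(\<surd>P\<^sub>T\<^sub>-\<^sub>\<tau> f))\<close>, which for an unbounded Laplacian requires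
  moving \<open>\<Delta>\<close> past the semigroup, one shows that
  \<open>w = \<tau>\<^sup>2 \<Gamma>(\<surd>u) - \<tau>\<^sup>2 \<Delta>u / 2 - n \<tau> u / 2\<close> satisfies \<open>\<partial>\<^sub>\<tau> w \<le> \<Delta>w\<close>. This is a pointwise consequence of the curvature
  condition (\<open>CDE'_linearized\<close>), because \<open>\<partial>\<^sub>\<tau> \<Gamma>(\<surd>u) = \<Delta>\<Gamma>(\<surd>u) - 2 \<Gamma>\<close>-tilde-two of \<open>\<surd>u\<close>. Since \<open>w = 0\<close> at time \<open>0\<close>,
  an elementary maximum principle gives \<open>w \<le> 0\<close>, provided that the positive part of \<open>w\<close> tends to \<open>0\<close> at infinity
  uniformly on bounded time intervals.

  The decay comes from compactness. As \<open>\<Delta>u = P\<^sub>\<tau> \<Delta>f\<close>, the term \<open>\<Delta>u\<close> runs through a norm compact piece of an orbit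
  in \<open>\<ell>\<^sup>2\<close>, and on such a piece decay at infinity is uniform because the measure is bounded below
  (\<open>P_uniform_tail\<close>). The shift by \<open>\<epsilon>\<close> gives \<open>\<Gamma>(\<surd>u) \<le> \<Gamma>(P\<^sub>\<tau> f) / (4\<epsilon>)\<close>, and \<open>\<Gamma>(P\<^sub>\<tau> f)\<close> is summable with total
  mass the energy of \<open>P\<^sub>\<tau> f\<close>; Green's formula bounds the energy of \<open>v\<close> by \<open>\<parallel>v\<parallel> \<parallel>\<Delta>v\<parallel>\<close> (\<open>energy_le\<close>), so that the same
  compactness argument applies in the graph norm (\<open>Gam_P_uniform_tail\<close>). The maximum principle also shows that the
  semigroup is positive and bounded by \<open>1\<close> on functions bounded by \<open>1\<close>.

  By the Li--Yau inequality \<open>ln u + n ln \<tau>\<close> is nondecreasing in \<open>\<tau>\<close>, with slope at least a multiple of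
  \<open>(\<surd>(u(x) / u(y)) - 1)\<^sup>2\<close> at an endpoint \<open>y\<close> of an edge. Comparison with a Riccati equation turns this into the Harnack
  inequality across one edge (\<open>log_flow_edge\<close>); dividing the time interval evenly among the edges of a shortest path gives
  the general case. The inequality is linear in \<open>f\<close>, so it suffices to prove it for the point masses, that is, for
  the heat kernel, and to sum. The sums converge because a function in \<open>\<ell>\<^sup>p\<close> is bounded and the kernel has mass at most \<open>1\<close>.
\<close>

section \<open>Real sums and differential inequalities\<close>

lemma Cauchy_Schwarz_infsum:
  fixes w a b :: "'i \<Rightarrow> real"
  assumes w: "\<And>i. w i \<ge> 0"
    and a: "(\<lambda>i. w i * (a i)\<^sup>2) summable_on UNIV"
    and b: "(\<lambda>i. w i * (b i)\<^sup>2) summable_on UNIV"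
  shows "(\<lambda>i. w i * a i * b i) summable_on UNIV"
    and "\<bar>\<Sum>\<^sub>\<infinity>i. w i * a i * b i\<bar> \<le> sqrt (\<Sum>\<^sub>\<infinity>i. w i * (a i)\<^sup>2) * sqrt (\<Sum>\<^sub>\<infinity>i. w i * (b i)\<^sup>2)"
proof -
  have bound: "(\<Sum>i\<in>F. \<bar>w i * a i * b i\<bar>) \<le>
      sqrt (\<Sum>\<^sub>\<infinity>i. w i * (a i)\<^sup>2) * sqrt (\<Sum>\<^sub>\<infinity>i. w i * (b i)\<^sup>2)" if "finite F" for F
  proof -
    have "(\<Sum>i\<in>F. \<bar>w i * a i * b i\<bar>) =
        (\<Sum>i\<in>F. \<bar>sqrt (w i) * a i\<bar> * \<bar>sqrt (w i) * b i\<bar>)"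
    proof (intro sum.cong refl)
      fix i
      have "\<bar>sqrt (w i) * a i\<bar> * \<bar>sqrt (w i) * b i\<bar> = (sqrt (w i))\<^sup>2 * \<bar>a i\<bar> * \<bar>b i\<bar>"
        by (simp add: abs_mult power2_eq_square)
      then show "\<bar>w i * a i * b i\<bar> = \<bar>sqrt (w i) * a i\<bar> * \<bar>sqrt (w i) * b i\<bar>"
        using w[of i] by (simp add: abs_mult)
    qed
    also have "\<dots> \<le> L2_set (\<lambda>i. sqrt (w i) * a i) F * L2_set (\<lambda>i. sqrt (w i) * b i) F"
      by (rule L2_set_mult_ineq)
    also have "\<dots> = sqrt (\<Sum>i\<in>F. w i * (a i)\<^sup>2) * sqrt (\<Sum>i\<in>F. w i * (b i)\<^sup>2)"
      by (simp add: L2_set_def power_mult_distrib w)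
    also have "\<dots> \<le> sqrt (\<Sum>\<^sub>\<infinity>i. w i * (a i)\<^sup>2) * sqrt (\<Sum>\<^sub>\<infinity>i. w i * (b i)\<^sup>2)"
      using that w by (intro mult_mono real_sqrt_le_mono finite_sum_le_infsum a b)
        (auto simp: sum_nonneg infsum_nonneg)
    finally show ?thesis .
  qed
  have abs_summable: "(\<lambda>i. \<bar>w i * a i * b i\<bar>) summable_on UNIV"
    by (rule nonneg_bdd_above_summable_on) (use bound in \<open>auto intro!: bdd_aboveI2\<close>)
  then show summable: "(\<lambda>i. w i * a i * b i) summable_on UNIV"
    using summable_on_iff_abs_summable_on_real by auto
  have "\<bar>\<Sum>\<^sub>\<infinity>i. w i * a i * b i\<bar> \<le> (\<Sum>\<^sub>\<infinity>i. \<bar>w i * a i * b i\<bar>)"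
    using norm_infsum_le[OF has_sum_infsum[OF summable] has_sum_infsum[OF abs_summable]] by simp
  also have "\<dots> \<le> sqrt (\<Sum>\<^sub>\<infinity>i. w i * (a i)\<^sup>2) * sqrt (\<Sum>\<^sub>\<infinity>i. w i * (b i)\<^sup>2)"
    by (rule infsum_le_finite_sums[OF abs_summable]) (use bound in auto)
  finally show "\<bar>\<Sum>\<^sub>\<infinity>i. w i * a i * b i\<bar> \<le>
      sqrt (\<Sum>\<^sub>\<infinity>i. w i * (a i)\<^sup>2) * sqrt (\<Sum>\<^sub>\<infinity>i. w i * (b i)\<^sup>2)" .
qed

lemma finite_superlevel_set:
  fixes g :: "'i \<Rightarrow> real"
  assumes g: "\<And>i. g i \<ge> 0" and bound: "\<And>F. finite F \<Longrightarrow> sum g F \<le> C" and "\<kappa> > 0"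
  shows "finite {i. g i > \<kappa>}"
proof -
  have "card F \<le> nat \<lceil>C / \<kappa>\<rceil>" if F: "F \<subseteq> {i. g i > \<kappa>}" "finite F" for F
  proof -
    have "real (card F) * \<kappa> \<le> sum g F"
      using sum_bounded_below[of F \<kappa> g] F by (force simp: less_imp_le)
    also have "\<dots> \<le> C" by (rule bound[OF F(2)])
    finally have "real (card F) \<le> C / \<kappa>" using \<open>\<kappa> > 0\<close> by (simp add: field_simps)
    then show ?thesis by linarith
  qed
  then show ?thesis using finite_if_finite_subsets_card_bdd by blast
qed

lemma filterlim_abs_at_right_0: "filterlim (\<lambda>h :: real. \<bar>h\<bar>) (at_right 0) (at 0)"
  unfolding filterlim_at
  by (auto simp: eventually_at_filter intro!: tendsto_eq_intros)

text \<open>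
  Only finitely many grid times \<open>i \<delta>\<close> occur for \<open>\<tau> \<le> T\<close>; they replace the choice of a finite subcover in the compactness
  arguments for orbits of the semigroup.
\<close>

lemma uniform_grid:
  fixes \<delta> T \<tau> :: real
  assumes "\<delta> > 0" "0 \<le> \<tau>" "\<tau> \<le> T"
  obtains i :: nat and r where "i \<le> nat \<lfloor>T / \<delta>\<rfloor>" "0 \<le> r" "r < \<delta>" "\<tau> = real i * \<delta> + r"
proof
  let ?i = "nat \<lfloor>\<tau> / \<delta>\<rfloor>"
  have i: "real ?i = of_int \<lfloor>\<tau> / \<delta>\<rfloor>" using assms by simp
  show "?i \<le> nat \<lfloor>T / \<delta>\<rfloor>" using assms by (intro nat_mono floor_mono divide_right_mono) auto
  have "real ?i * \<delta> \<le> \<tau>" "\<tau> < real ?i * \<delta> + \<delta>"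
    unfolding i using floor_divide_lower[OF assms(1), of \<tau>] floor_divide_upper[OF assms(1), of \<tau>]
    by (simp_all add: distrib_right)
  then show "0 \<le> \<tau> - real ?i * \<delta>" "\<tau> - real ?i * \<delta> < \<delta>" by auto
  show "\<tau> = real ?i * \<delta> + (\<tau> - real ?i * \<delta>)" by simp
qed

text \<open>
  While \<open>D\<close> is positive, \<open>(1 / D)' = - D' / D\<^sup>2 \<ge> k\<close>. So \<open>1 / D\<close> grows at least at rate \<open>k\<close> from a positive initial value,
  however large \<open>D t\<close> is.
\<close>

lemma Riccati_comparison:
  fixes D D' :: "real \<Rightarrow> real"
  assumes "t < s" and "k > 0"
    and deriv: "\<And>\<tau>. t \<le> \<tau> \<Longrightarrow> \<tau> \<le> s \<Longrightarrow> (D has_real_derivative D' \<tau>) (at \<tau>)"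
    and dec: "\<And>\<tau>. t \<le> \<tau> \<Longrightarrow> \<tau> \<le> s \<Longrightarrow> D' \<tau> \<le> 0"
    and Riccati: "\<And>\<tau>. t \<le> \<tau> \<Longrightarrow> \<tau> \<le> s \<Longrightarrow> D \<tau> > 0 \<Longrightarrow> D' \<tau> \<le> - k * (D \<tau>)\<^sup>2"
  shows "D s \<le> 1 / (k * (s - t))"
proof (cases "D s \<le> 0")
  case True
  moreover have "0 \<le> 1 / (k * (s - t))" using assms(1,2) by simp
  ultimately show ?thesis by linarith
next
  case False
  have pos: "D \<tau> > 0" if "t \<le> \<tau>" "\<tau> \<le> s" for \<tau>
  proof -
    have "D s \<le> D \<tau>"
      by (rule DERIV_nonpos_imp_nonincreasing[OF that(2)]) (use deriv dec that in force)
    then show ?thesis using False by linarith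
  qed
  have "1 / D t - k * t \<le> 1 / D s - k * s"
  proof (rule DERIV_nonneg_imp_nondecreasing[where f = "\<lambda>\<tau>. 1 / D \<tau> - k * \<tau>"])
    fix \<tau> assume \<tau>: "t \<le> \<tau>" "\<tau> \<le> s"
    have "((\<lambda>\<tau>. 1 / D \<tau> - k * \<tau>) has_real_derivative - D' \<tau> / (D \<tau>)\<^sup>2 - k) (at \<tau>)"
      using pos[OF \<tau>] by (auto intro!: derivative_eq_intros deriv \<tau> simp: power2_eq_square)
    moreover have "- D' \<tau> / (D \<tau>)\<^sup>2 - k \<ge> 0"
      using Riccati[OF \<tau> pos[OF \<tau>]] pos[OF \<tau>] by (simp add: field_simps)
    ultimately show "\<exists>d. ((\<lambda>\<tau>. 1 / D \<tau> - k * \<tau>) has_real_derivative d) (at \<tau>) \<and> 0 \<le> d" by blast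
  qed (use \<open>t < s\<close> in simp)
  moreover have "1 / D t > 0" using pos[of t] \<open>t < s\<close> by simp
  ultimately have "k * (s - t) \<le> 1 / D s" unfolding right_diff_distrib by linarith
  moreover have "k * (s - t) > 0" "D s > 0" using assms(1,2) False by simp_all
  ultimately show ?thesis by (simp add: field_simps)
qed

text \<open>
  This rule rewrites the exponent in \<open>lp G 2\<close>, after which facts about \<open>\<ell>\<^sup>2\<close> no longer match.
\<close>

declare numeral_eq_ereal [simp del]

context weighted_graph
begin

lemma wt_nonneg: "wt G x y \<ge> 0"
  using wt_pos[of x y] wt_zero[of x y] by (cases "(x, y) \<in> edges G") auto

lemma meas_nonneg: "meas G x \<ge> 0"
  using meas_pos[of x] by simp

section \<open>Square summable functions\<close>

lemma l2_iff: "f \<in> lp G 2 \<longleftrightarrow> (\<lambda>x. meas G x * (f x)\<^sup>2) summable_on UNIV"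
proof -
  have "\<bar>r\<bar> powr 2 = r\<^sup>2" for r :: real
    by (cases "r = 0") (simp_all add: powr_numeral)
  then show ?thesis by (simp add: lp_def numeral_eq_ereal mult.commute)
qed

lemma l2_norm_eq: "l2_norm G f = sqrt (\<Sum>\<^sub>\<infinity>x. meas G x * (f x)\<^sup>2)"
  by (simp add: l2_norm_def l2_inner_def power2_eq_square mult_ac)

lemma l2_norm_nonneg: "l2_norm G f \<ge> 0"
  by (simp add: l2_norm_eq infsum_nonneg meas_nonneg)

lemma l2_norm_sq: "(l2_norm G f)\<^sup>2 = (\<Sum>\<^sub>\<infinity>x. meas G x * (f x)\<^sup>2)"
  by (simp add: l2_norm_eq infsum_nonneg meas_nonneg)

lemma l2_inner_le:
  assumes "f \<in> lp G 2" "g \<in> lp G 2"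
  shows "(\<lambda>x. f x * g x * meas G x) summable_on UNIV"
    and "\<bar>l2_inner G f g\<bar> \<le> l2_norm G f * l2_norm G g"
  using Cauchy_Schwarz_infsum[of "meas G" f g] assms meas_nonneg
  by (simp_all add: l2_iff l2_norm_eq l2_inner_def mult_ac)

lemma l2_finite_sum_le:
  assumes "f \<in> lp G 2" "finite F"
  shows "(\<Sum>x\<in>F. meas G x * (f x)\<^sup>2) \<le> (l2_norm G f)\<^sup>2"
  unfolding l2_norm_sq using assms meas_nonneg
  by (intro finite_sum_le_infsum) (auto simp: l2_iff)

lemma l2_eval_le:
  assumes "f \<in> lp G 2"
  shows "\<bar>f x\<bar> \<le> l2_norm G f / sqrt (meas G x)"
proof -
  have "(sqrt (meas G x) * \<bar>f x\<bar>)\<^sup>2 \<le> (l2_norm G f)\<^sup>2"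
    using l2_finite_sum_le[OF assms, of "{x}"] meas_nonneg[of x] by (simp add: power_mult_distrib)
  then have "sqrt (meas G x) * \<bar>f x\<bar> \<le> l2_norm G f"
    by (rule power2_le_imp_le) (rule l2_norm_nonneg)
  then show ?thesis using meas_pos[of x] by (simp add: field_simps)
qed

lemma l2_scale: "f \<in> lp G 2 \<Longrightarrow> (\<lambda>x. c * f x) \<in> lp G 2"
  using summable_on_cmult_right[of "\<lambda>x. meas G x * (f x)\<^sup>2" UNIV "c\<^sup>2"]
  by (simp add: l2_iff power_mult_distrib mult_ac)

lemma l2_diff:
  assumes "f \<in> lp G 2" "g \<in> lp G 2"
  shows "(\<lambda>x. f x - g x) \<in> lp G 2"
    and "l2_norm G (\<lambda>x. f x - g x) \<le> l2_norm G f + l2_norm G g"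
proof -
  have sf: "(\<lambda>x. meas G x * (f x)\<^sup>2) summable_on UNIV"
    and sg: "(\<lambda>x. meas G x * (g x)\<^sup>2) summable_on UNIV"
    using assms by (simp_all add: l2_iff)
  have sfg: "(\<lambda>x. - 2 * (f x * g x * meas G x)) summable_on UNIV"
    by (intro summable_on_cmult_right l2_inner_le assms)
  have eq: "meas G x * (f x - g x)\<^sup>2 =
      (meas G x * (f x)\<^sup>2 + meas G x * (g x)\<^sup>2) + - 2 * (f x * g x * meas G x)" for x
    by (simp add: power2_eq_square algebra_simps)
  show mem: "(\<lambda>x. f x - g x) \<in> lp G 2"
    unfolding l2_iff eq by (intro summable_on_add sf sg sfg)
  have "(l2_norm G (\<lambda>x. f x - g x))\<^sup>2 =
      (l2_norm G f)\<^sup>2 + (l2_norm G g)\<^sup>2 + - 2 * l2_inner G f g"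
    unfolding l2_norm_sq eq
    by (simp only: infsum_add[OF summable_on_add[OF sf sg] sfg] infsum_add[OF sf sg]
        infsum_cmult_right' l2_inner_def)
  also have "\<dots> \<le> (l2_norm G f + l2_norm G g)\<^sup>2"
    using l2_inner_le(2)[OF assms] by (simp add: power2_eq_square algebra_simps)
  finally show "l2_norm G (\<lambda>x. f x - g x) \<le> l2_norm G f + l2_norm G g"
    by (rule power2_le_imp_le) (simp add: l2_norm_nonneg)
qed

lemma C0_l2: "f \<in> C0 \<Longrightarrow> f \<in> lp G 2"
  unfolding l2_iff C0_def
  by (subst summable_on_cong_neutral[of "{x. f x \<noteq> 0}" UNIV _ "\<lambda>x. meas G x * (f x)\<^sup>2"]) auto

section \<open>Green's formula\<close>

lemma nbrs_iff: "y \<in> nbrs G x \<longleftrightarrow> (x, y) \<in> edges G"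
  by (simp add: nbrs_def)

lemma nbrs_sym: "y \<in> nbrs G x \<longleftrightarrow> x \<in> nbrs G y"
  using edges_sym by (auto simp: nbrs_def sym_def)

lemma meas_mult_Lap: "meas G x * Lap G f x = (\<Sum>y\<in>nbrs G x. wt G x y * (f y - f x))"
  using meas_pos[of x] by (simp add: Lap_def)

lemma meas_mult_Gam: "meas G x * Gam G f f x = (\<Sum>y\<in>nbrs G x. wt G x y * (f y - f x)\<^sup>2) / 2"
  using meas_pos[of x] by (simp add: Gam_def power2_eq_square mult_ac)

lemma Gam_nonneg: "Gam G f f x \<ge> 0"
proof -
  have "meas G x * Gam G f f x \<ge> 0"
    unfolding meas_mult_Gam by (simp add: sum_nonneg wt_nonneg)
  then show ?thesis using meas_pos[of x] by (simp add: zero_le_mult_iff)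
qed

lemma Lap_C0:
  assumes "f \<in> C0"
  shows "Lap G f \<in> C0"
proof -
  have "Lap G f x = 0" if "x \<notin> {x. f x \<noteq> 0} \<union> (\<Union>y\<in>{x. f x \<noteq> 0}. nbrs G y)" for x
    using that unfolding Lap_def by (subst sum.neutral) (auto simp: nbrs_sym[of _ x])
  then have "{x. Lap G f x \<noteq> 0} \<subseteq> {x. f x \<noteq> 0} \<union> (\<Union>y\<in>{x. f x \<noteq> 0}. nbrs G y)" by blast
  moreover have "finite ({x. f x \<noteq> 0} \<union> (\<Union>y\<in>{x. f x \<noteq> 0}. nbrs G y))"
    using assms locally_finite by (auto simp: C0_def)
  ultimately show ?thesis unfolding C0_def using finite_subset by blast
qed

text \<open>
  If one of the two functions has finite support, the form is a finite sum, because only the finitely many edges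
  that meet the support contribute. Exchanging the endpoints of every edge then moves both differences to one side.
\<close>

lemma energy_C0:
  fixes u \<phi> :: "'v \<Rightarrow> real"
  assumes "\<phi> \<in> C0"
  shows "(\<Sum>\<^sub>\<infinity>(x, y). wt G x y * (u y - u x) * (\<phi> y - \<phi> x)) = - 2 * l2_inner G \<phi> (Lap G u)"
    and "finite_energy G \<phi>"
proof -
  define S where "S = {x. \<phi> x \<noteq> 0}"
  define B where "B = S \<union> (\<Union>x\<in>S. nbrs G x)"
  have finS: "finite S" using assms by (simp add: C0_def S_def)
  have finB: "finite B" using finS locally_finite by (auto simp: B_def)
  have zero: "wt G x y = 0 \<or> \<phi> x = \<phi> y" if "(x, y) \<notin> B \<times> B" for x y
  proof (cases "(x, y) \<in> edges G")
    case True
    then have "x \<in> nbrs G y" "y \<in> nbrs G x" using nbrs_sym nbrs_iff by auto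
    then have "\<phi> x = 0" "\<phi> y = 0" using that by (auto simp: B_def S_def)
    then show ?thesis by simp
  qed (simp add: wt_zero)
  show "finite_energy G \<phi>"
    unfolding finite_energy_def
  proof (subst summable_on_cong_neutral[of "B \<times> B" UNIV _ "\<lambda>(x, y). wt G x y * (\<phi> y - \<phi> x)\<^sup>2"])
    show "(case e of (x, y) \<Rightarrow> wt G x y * (\<phi> y - \<phi> x)\<^sup>2) = 0" if "e \<in> UNIV - B \<times> B" for e
      using zero[of "fst e" "snd e"] that by (cases e) auto
  qed (use finB in auto)
  have row: "(\<Sum>y\<in>B. wt G x y * (u y - u x) * \<phi> x) = \<phi> x * Lap G u x * meas G x" for x
  proof (cases "x \<in> S")
    case True
    then have sub: "nbrs G x \<subseteq> B" by (auto simp: B_def)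
    have "(\<Sum>y\<in>B. wt G x y * (u y - u x)) = (\<Sum>y\<in>nbrs G x. wt G x y * (u y - u x))"
      by (rule sum.mono_neutral_right[OF finB sub]) (auto simp: nbrs_iff wt_zero)
    then show ?thesis
      by (simp add: sum_distrib_right[symmetric] meas_mult_Lap[symmetric])
  qed (simp add: S_def)
  \<comment> \<open>Both sums run over all oriented edges; reversing the orientation changes the sign of the increment of \<open>u\<close>.\<close>
  have swap: "(\<Sum>x\<in>B. \<Sum>y\<in>B. wt G x y * (u y - u x) * \<phi> y) =
      - (\<Sum>x\<in>B. \<Sum>y\<in>B. wt G x y * (u y - u x) * \<phi> x)"
  proof -
    have "wt G x y * (u y - u x) * \<phi> y = - (wt G y x * (u x - u y) * \<phi> y)" for x y
      by (simp add: wt_sym[of x y] algebra_simps)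
    then have "(\<Sum>x\<in>B. \<Sum>y\<in>B. wt G x y * (u y - u x) * \<phi> y) =
        - (\<Sum>x\<in>B. \<Sum>y\<in>B. wt G y x * (u x - u y) * \<phi> y)"
      by (simp add: sum_negf)
    also have "(\<Sum>x\<in>B. \<Sum>y\<in>B. wt G y x * (u x - u y) * \<phi> y) =
        (\<Sum>x\<in>B. \<Sum>y\<in>B. wt G x y * (u y - u x) * \<phi> x)"
      by (rule sum.swap)
    finally show ?thesis .
  qed
  have "(\<Sum>\<^sub>\<infinity>(x, y). wt G x y * (u y - u x) * (\<phi> y - \<phi> x)) =
      (\<Sum>\<^sub>\<infinity>(x, y)\<in>B \<times> B. wt G x y * (u y - u x) * (\<phi> y - \<phi> x))"
  proof (rule infsum_cong_neutral)
    show "(case e of (x, y) \<Rightarrow> wt G x y * (u y - u x) * (\<phi> y - \<phi> x)) = 0"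
      if "e \<in> UNIV - B \<times> B" for e
      using zero[of "fst e" "snd e"] that by (cases e) auto
  qed auto
  also have "\<dots> = (\<Sum>x\<in>B. \<Sum>y\<in>B. wt G x y * (u y - u x) * (\<phi> y - \<phi> x))"
    using finB by (simp add: sum.cartesian_product)
  also have "\<dots> = - 2 * (\<Sum>x\<in>B. \<Sum>y\<in>B. wt G x y * (u y - u x) * \<phi> x)"
    using swap by (simp add: right_diff_distrib sum_subtractf)
  also have "(\<Sum>x\<in>B. \<Sum>y\<in>B. wt G x y * (u y - u x) * \<phi> x) =
      (\<Sum>x\<in>B. \<phi> x * Lap G u x * meas G x)"
    by (simp add: row)
  also have "\<dots> = l2_inner G \<phi> (Lap G u)"
    unfolding l2_inner_def infsum_finite[OF finB, symmetric]
    by (rule infsum_cong_neutral) (auto simp: B_def S_def)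
  finally show "(\<Sum>\<^sub>\<infinity>(x, y). wt G x y * (u y - u x) * (\<phi> y - \<phi> x)) = - 2 * l2_inner G \<phi> (Lap G u)" .
qed

lemma C0_dom_Lap:
  assumes "f \<in> C0"
  shows "f \<in> dom_Lap G"
proof -
  have "(\<lambda>k. Q_norm G (\<lambda>x. f x - f x)) \<longlonglongrightarrow> 0"
    by (simp add: Q_norm_def l2_norm_def l2_inner_def energy_def case_prod_unfold)
  then have "\<exists>\<phi> :: nat \<Rightarrow> 'v \<Rightarrow> real. (\<forall>k. \<phi> k \<in> C0) \<and> (\<lambda>k. Q_norm G (\<lambda>x. f x - \<phi> k x)) \<longlonglongrightarrow> 0"
    using assms by (intro exI[of _ "\<lambda>_. f"]) simp
  then show ?thesis
    using assms by (simp add: dom_Lap_def dom_Q_def C0_l2 Lap_C0 energy_C0(2))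
qed

lemma finite_energy_iff:
  "finite_energy G u \<longleftrightarrow> (\<lambda>e. wt G (fst e) (snd e) * (u (snd e) - u (fst e))\<^sup>2) summable_on UNIV"
  by (simp add: finite_energy_def case_prod_unfold)

lemma energy_eq: "energy G u u = (\<Sum>\<^sub>\<infinity>e. wt G (fst e) (snd e) * (u (snd e) - u (fst e))\<^sup>2) / 2"
  by (simp add: energy_def case_prod_unfold power2_eq_square mult_ac)

lemma energy_nonneg: "energy G u u \<ge> 0"
  by (simp add: energy_eq infsum_nonneg wt_nonneg)

text \<open>
  Green's formula \<open>Q(u, u) = - \<langle>u, \<Delta>u\<rangle>\<close>, in the form of an inequality. A function in the domain of the form is approximated
  by finitely supported \<open>\<phi>\<close>, for which \<open>Q(u, \<phi>) = - \<langle>\<phi>, \<Delta>u\<rangle>\<close>; the errors are controlled by the form norm of \<open>u - \<phi>\<close>.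
\<close>

lemma energy_le:
  assumes "u \<in> dom_Lap G"
  shows "energy G u u \<le> l2_norm G u * l2_norm G (Lap G u)"
proof -
  let ?w = "\<lambda>e. wt G (fst e) (snd e)"
  let ?d = "\<lambda>(f :: 'v \<Rightarrow> real) e. f (snd e) - f (fst e)"
  from assms obtain \<phi> where u: "u \<in> lp G 2" "Lap G u \<in> lp G 2" "finite_energy G u"
    and \<phi>: "\<And>k. \<phi> k \<in> C0" and lim: "(\<lambda>k. Q_norm G (\<lambda>x. u x - \<phi> k x)) \<longlonglongrightarrow> 0"
    by (auto simp: dom_Lap_def dom_Q_def)
  define q where "q = (\<lambda>k. Q_norm G (\<lambda>x. u x - \<phi> k x))"
  have su: "(\<lambda>e. ?w e * (?d u e)\<^sup>2) summable_on UNIV" using u(3) by (simp add: finite_energy_iff)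
  have est: "2 * energy G u u \<le> 2 * (l2_norm G u * l2_norm G (Lap G u)) +
      (2 * l2_norm G (Lap G u) + sqrt (2 * energy G u u) * sqrt 2) * q k" for k
  proof -
    define \<psi> where "\<psi> = (\<lambda>x. u x - \<phi> k x)"
    have sphi: "(\<lambda>e. ?w e * (?d (\<phi> k) e)\<^sup>2) summable_on UNIV"
      using energy_C0(2)[OF \<phi>] by (simp add: finite_energy_iff)
    have suphi: "(\<lambda>e. ?w e * ?d u e * ?d (\<phi> k) e) summable_on UNIV"
      by (rule Cauchy_Schwarz_infsum(1)[OF wt_nonneg su sphi])
    have "?w e * (?d \<psi> e)\<^sup>2 = (?w e * (?d u e)\<^sup>2 + ?w e * (?d (\<phi> k) e)\<^sup>2) +
        - 2 * (?w e * ?d u e * ?d (\<phi> k) e)" for e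
      by (simp add: \<psi>_def power2_eq_square algebra_simps)
    then have spsi: "(\<lambda>e. ?w e * (?d \<psi> e)\<^sup>2) summable_on UNIV"
      by (simp only:) (intro summable_on_add summable_on_cmult_right su sphi suphi)
    have supsi: "(\<lambda>e. ?w e * ?d u e * ?d \<psi> e) summable_on UNIV"
      by (rule Cauchy_Schwarz_infsum(1)[OF wt_nonneg su spsi])
    have q_sq: "(q k)\<^sup>2 = (l2_norm G \<psi>)\<^sup>2 + energy G \<psi> \<psi>"
      by (simp add: q_def Q_norm_def \<psi>_def energy_nonneg)
    have q0: "q k \<ge> 0" by (simp add: q_def Q_norm_def energy_nonneg)
    have psi1: "l2_norm G \<psi> \<le> q k"
      by (rule power2_le_imp_le) (use q_sq q0 energy_nonneg[of \<psi>] in auto)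
    have psi2: "sqrt (2 * energy G \<psi> \<psi>) \<le> sqrt 2 * q k"
      by (rule real_le_lsqrt) (use q_sq q0 in \<open>auto simp: power_mult_distrib\<close>)
    have psi_l2: "\<psi> \<in> lp G 2" unfolding \<psi>_def by (intro l2_diff u C0_l2 \<phi>)
    have "2 * energy G u u =
        (\<Sum>\<^sub>\<infinity>e. ?w e * ?d u e * ?d (\<phi> k) e + ?w e * ?d u e * ?d \<psi> e)"
      unfolding energy_eq \<psi>_def by (simp add: power2_eq_square algebra_simps)
    also have "\<dots> = (\<Sum>\<^sub>\<infinity>e. ?w e * ?d u e * ?d (\<phi> k) e) + (\<Sum>\<^sub>\<infinity>e. ?w e * ?d u e * ?d \<psi> e)"
      by (rule infsum_add[OF suphi supsi])
    also have "(\<Sum>\<^sub>\<infinity>e. ?w e * ?d u e * ?d (\<phi> k) e) = - 2 * l2_inner G (\<phi> k) (Lap G u)"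
      using energy_C0(1)[OF \<phi>[of k], of u] by (simp add: case_prod_unfold)
    also have "l2_inner G (\<phi> k) (Lap G u) = l2_inner G u (Lap G u) - l2_inner G \<psi> (Lap G u)"
      using infsum_add[OF l2_inner_le(1)[OF C0_l2[OF \<phi>[of k]] u(2)] l2_inner_le(1)[OF psi_l2 u(2)]]
      by (simp add: \<psi>_def l2_inner_def algebra_simps)
    also have "- 2 * (l2_inner G u (Lap G u) - l2_inner G \<psi> (Lap G u)) +
          (\<Sum>\<^sub>\<infinity>e. ?w e * ?d u e * ?d \<psi> e) \<le>
        2 * (l2_norm G u * l2_norm G (Lap G u)) + 2 * (q k * l2_norm G (Lap G u)) +
          sqrt (2 * energy G u u) * (sqrt 2 * q k)"
    proof -
      have 1: "\<bar>l2_inner G u (Lap G u)\<bar> \<le> l2_norm G u * l2_norm G (Lap G u)"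
        by (rule l2_inner_le(2)[OF u(1,2)])
      have "\<bar>l2_inner G \<psi> (Lap G u)\<bar> \<le> l2_norm G \<psi> * l2_norm G (Lap G u)"
        by (rule l2_inner_le(2)[OF psi_l2 u(2)])
      also have "\<dots> \<le> q k * l2_norm G (Lap G u)"
        by (rule mult_right_mono[OF psi1 l2_norm_nonneg])
      finally have 2: "\<bar>l2_inner G \<psi> (Lap G u)\<bar> \<le> q k * l2_norm G (Lap G u)" .
      have "\<bar>\<Sum>\<^sub>\<infinity>e. ?w e * ?d u e * ?d \<psi> e\<bar> \<le> sqrt (2 * energy G u u) * sqrt (2 * energy G \<psi> \<psi>)"
        using Cauchy_Schwarz_infsum(2)[OF wt_nonneg su spsi] by (simp add: energy_eq)
      also have "\<dots> \<le> sqrt (2 * energy G u u) * (sqrt 2 * q k)"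
        by (rule mult_left_mono[OF psi2]) (simp add: energy_nonneg)
      finally have 3: "\<bar>\<Sum>\<^sub>\<infinity>e. ?w e * ?d u e * ?d \<psi> e\<bar> \<le> sqrt (2 * energy G u u) * (sqrt 2 * q k)" .
      have "- 2 * (a - b) + c \<le> 2 * A + 2 * B + C"
        if "\<bar>a\<bar> \<le> A" "\<bar>b\<bar> \<le> B" "\<bar>c\<bar> \<le> C" for a b c A B C :: real
        using that by (simp add: abs_le_iff)
      from this[OF 1 2 3] show ?thesis .
    qed
    finally show ?thesis by (simp add: algebra_simps)
  qed
  have "(\<lambda>k. 2 * (l2_norm G u * l2_norm G (Lap G u)) +
      (2 * l2_norm G (Lap G u) + sqrt (2 * energy G u u) * sqrt 2) * q k) \<longlonglongrightarrow>
      2 * (l2_norm G u * l2_norm G (Lap G u)) +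
      (2 * l2_norm G (Lap G u) + sqrt (2 * energy G u u) * sqrt 2) * 0"
    by (intro tendsto_intros) (use lim in \<open>simp add: q_def\<close>)
  then have "2 * energy G u u \<le> 2 * (l2_norm G u * l2_norm G (Lap G u)) +
      (2 * l2_norm G (Lap G u) + sqrt (2 * energy G u u) * sqrt 2) * 0"
    by (rule LIMSEQ_le_const) (use est in auto)
  then show ?thesis by simp
qed

lemma sum_Gam_le_energy:
  assumes "finite_energy G u" "finite F"
  shows "(\<Sum>x\<in>F. meas G x * Gam G u u x) \<le> energy G u u"
proof -
  have "(\<Sum>x\<in>F. meas G x * Gam G u u x) =
      (\<Sum>x\<in>F. \<Sum>y\<in>nbrs G x. wt G x y * (u y - u x)\<^sup>2) / 2"
    by (simp add: meas_mult_Gam sum_divide_distrib)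
  also have "(\<Sum>x\<in>F. \<Sum>y\<in>nbrs G x. wt G x y * (u y - u x)\<^sup>2) =
      (\<Sum>e\<in>Sigma F (nbrs G). wt G (fst e) (snd e) * (u (snd e) - u (fst e))\<^sup>2)"
    using assms locally_finite by (subst sum.Sigma) (auto simp: case_prod_unfold)
  also have "\<dots> \<le> (\<Sum>\<^sub>\<infinity>e. wt G (fst e) (snd e) * (u (snd e) - u (fst e))\<^sup>2)"
    using assms locally_finite
    by (intro finite_sum_le_infsum) (auto simp: finite_energy_iff wt_nonneg)
  finally show ?thesis by (simp add: energy_eq)
qed

lemma Lap_diff: "Lap G (\<lambda>y. f y - g y) x = Lap G f x - Lap G g x"
  by (simp add: Lap_def algebra_simps sum.distrib sum_subtractf add_divide_distrib diff_divide_distrib)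

lemma Lap_scale: "Lap G (\<lambda>y. c * f y) x = c * Lap G f x"
  by (simp add: Lap_def algebra_simps sum_distrib_left sum_subtractf)

lemma Lap_add_const: "Lap G (\<lambda>y. f y + c) x = Lap G f x"
  by (simp add: Lap_def)

lemma Lap_diff_const: "Lap G (\<lambda>y. f y - c) x = Lap G f x"
  by (simp add: Lap_def)

text \<open>
  A weak triangle inequality: \<open>\<surd>\<Gamma>\<close> is a seminorm, and squaring costs a factor \<open>2\<close>.
\<close>

lemma Gam_diff_le: "Gam G f f x \<le> 2 * Gam G g g x + 2 * Gam G (\<lambda>y. f y - g y) (\<lambda>y. f y - g y) x"
proof -
  have "wt G x y * (f y - f x)\<^sup>2 \<le> 2 * (wt G x y * (g y - g x)\<^sup>2) +
      2 * (wt G x y * ((f y - g y) - (f x - g x))\<^sup>2)" for y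
  proof -
    have "(f y - f x)\<^sup>2 \<le> 2 * (g y - g x)\<^sup>2 + 2 * ((f y - g y) - (f x - g x))\<^sup>2"
      using sum_squares_ge_zero[of "(g y - g x) - ((f y - g y) - (f x - g x))" 0]
      by (simp add: power2_eq_square algebra_simps)
    from mult_left_mono[OF this wt_nonneg[of x y]] show ?thesis by (simp add: algebra_simps)
  qed
  then have "(\<Sum>y\<in>nbrs G x. wt G x y * (f y - f x)\<^sup>2) \<le>
      (\<Sum>y\<in>nbrs G x. 2 * (wt G x y * (g y - g x)\<^sup>2) +
        2 * (wt G x y * ((f y - g y) - (f x - g x))\<^sup>2))"
    by (rule sum_mono)
  then have "meas G x * Gam G f f x \<le> meas G x *
      (2 * Gam G g g x + 2 * Gam G (\<lambda>y. f y - g y) (\<lambda>y. f y - g y) x)"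
    using meas_mult_Gam[of x f] meas_mult_Gam[of x g] meas_mult_Gam[of x "\<lambda>y. f y - g y"]
    by (simp add: sum.distrib sum_distrib_left[symmetric] distrib_left)
  then show ?thesis using meas_pos[of x] by simp
qed

end


section \<open>The heat semigroup\<close>

locale heat_flow = weighted_graph G
  for G :: "'v wgraph" +
  fixes P :: "real \<Rightarrow> ('v \<Rightarrow> real) \<Rightarrow> 'v \<Rightarrow> real"
  assumes heat: "heat_semigroup G P"
    and nondegenerate: "nondegenerate G"
begin

definition m_min :: real where "m_min = (INF x. meas G x)"

lemma m_min_pos: "m_min > 0"
  using nondegenerate by (simp add: m_min_def nondegenerate_def)

lemma m_min_le: "m_min \<le> meas G x"
  unfolding m_min_def by (rule cINF_lower) (auto intro!: bdd_belowI2 meas_nonneg)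

lemma P_l2: "t \<ge> 0 \<Longrightarrow> f \<in> lp G 2 \<Longrightarrow> P t f \<in> lp G 2"
  and P_contraction: "t \<ge> 0 \<Longrightarrow> f \<in> lp G 2 \<Longrightarrow> l2_norm G (P t f) \<le> l2_norm G f"
  and P_0: "f \<in> lp G 2 \<Longrightarrow> P 0 f = f"
  and P_add: "s \<ge> 0 \<Longrightarrow> t \<ge> 0 \<Longrightarrow> f \<in> lp G 2 \<Longrightarrow> P (s + t) f = P s (P t f)"
  and P_lincomb: "t \<ge> 0 \<Longrightarrow> f \<in> lp G 2 \<Longrightarrow> g \<in> lp G 2 \<Longrightarrow>
        P t (\<lambda>x. a * f x + b * g x) = (\<lambda>x. a * P t f x + b * P t g x)"
  and P_continuous_0: "f \<in> lp G 2 \<Longrightarrow> ((\<lambda>t. l2_norm G (\<lambda>x. P t f x - f x)) \<longlongrightarrow> 0) (at_right 0)"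
  using heat by (auto simp: heat_semigroup_def symmetric_contraction_semigroup_def)

lemma P_scale: "t \<ge> 0 \<Longrightarrow> f \<in> lp G 2 \<Longrightarrow> P t (\<lambda>x. c * f x) = (\<lambda>x. c * P t f x)"
  using P_lincomb[of t f f c 0] by simp

lemma P_diff: "t \<ge> 0 \<Longrightarrow> f \<in> lp G 2 \<Longrightarrow> g \<in> lp G 2 \<Longrightarrow>
    P t (\<lambda>x. f x - g x) = (\<lambda>x. P t f x - P t g x)"
  using P_lincomb[of t f g 1 "-1"] by simp

lemma P_sum:
  assumes "t \<ge> 0" "finite F" "\<And>i. i \<in> F \<Longrightarrow> f i \<in> C0"
  shows "P t (\<lambda>x. \<Sum>i\<in>F. f i x) = (\<lambda>x. \<Sum>i\<in>F. P t (f i) x) \<and> (\<lambda>x. \<Sum>i\<in>F. f i x) \<in> C0"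
  using assms(2,3)
proof (induction F rule: finite_induct)
  case empty
  have "(\<lambda>x :: 'v. 0 :: real) \<in> C0" by (simp add: C0_def)
  then show ?case using P_scale[OF assms(1) C0_l2, of "\<lambda>x. 0" 0] by (simp add: fun_eq_iff)
next
  case (insert i F)
  have "f i \<in> C0" "(\<lambda>x. \<Sum>i\<in>F. f i x) \<in> C0" using insert by auto
  then have "(\<lambda>x. f i x + (\<Sum>i\<in>F. f i x)) \<in> C0"
    unfolding C0_def mem_Collect_eq
    by (rule finite_subset[rotated, OF finite_UnI]) auto
  moreover have "P t (\<lambda>x. f i x + (\<Sum>i\<in>F. f i x)) = (\<lambda>x. P t (f i) x + P t (\<lambda>x. \<Sum>i\<in>F. f i x) x)"
    using P_lincomb[OF assms(1) C0_l2 C0_l2, of "f i" "\<lambda>x. \<Sum>i\<in>F. f i x" 1 1] insert by simp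
  ultimately show ?case using insert by simp
qed

lemma P_increment:
  assumes "t \<ge> 0" "r \<ge> 0" "f \<in> lp G 2"
  shows "P (t + r) f x - P t f x = P t (\<lambda>x. P r f x - f x) x"
  by (simp add: P_add P_diff P_l2 assms)

lemma dom_Lap_l2: "f \<in> dom_Lap G \<Longrightarrow> f \<in> lp G 2" "f \<in> dom_Lap G \<Longrightarrow> Lap G f \<in> lp G 2"
  and dom_Lap_finite_energy: "f \<in> dom_Lap G \<Longrightarrow> finite_energy G f"
  by (simp_all add: dom_Lap_def dom_Q_def)

lemma generator_limit:
  assumes "f \<in> dom_Lap G"
  shows "((\<lambda>r. l2_norm G (\<lambda>x. (P r f x - f x) / r - Lap G f x)) \<longlongrightarrow> 0) (at_right 0)"
  using heat assms dom_Lap_l2[OF assms] by (auto simp: heat_semigroup_def)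

lemma generatorI:
  assumes "f \<in> lp G 2" "g \<in> lp G 2"
    and "((\<lambda>r. l2_norm G (\<lambda>x. (P r f x - f x) / r - g x)) \<longlongrightarrow> 0) (at_right 0)"
  shows "f \<in> dom_Lap G" "g = Lap G f"
  using heat assms by (auto simp: heat_semigroup_def)

lemma difference_quotient_l2:
  assumes "f \<in> dom_Lap G" "r \<ge> 0"
  shows "(\<lambda>x. (P r f x - f x) / r - Lap G f x) \<in> lp G 2"
proof -
  have "(\<lambda>x. (1 / r) * (P r f x - f x) - Lap G f x) \<in> lp G 2"
    using assms by (intro l2_diff l2_scale P_l2 dom_Lap_l2)
  then show ?thesis by simp
qed

lemma P_difference_quotient:
  assumes "f \<in> dom_Lap G" "t \<ge> 0" "r > 0"
  shows "P t (\<lambda>x. (P r f x - f x) / r - Lap G f x) =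
    (\<lambda>x. (P r (P t f) x - P t f x) / r - P t (Lap G f) x)"
proof -
  have l2: "f \<in> lp G 2" "P r f \<in> lp G 2" "Lap G f \<in> lp G 2" "P t f \<in> lp G 2"
    using assms by (auto intro: dom_Lap_l2 P_l2)
  have "P t (P r f) = P r (P t f)"
    using P_add[of t r f] P_add[of r t f] assms l2 by (simp add: add.commute)
  moreover have "P t (\<lambda>x. (1 / r) * (P r f x - f x) + (- 1) * Lap G f x) =
      (\<lambda>x. (1 / r) * P t (\<lambda>x. P r f x - f x) x + (- 1) * P t (Lap G f) x)"
    by (rule P_lincomb) (use assms l2 l2_diff in auto)
  ultimately show ?thesis
    using P_diff[OF assms(2) l2(2) l2(1)] by simp
qed

text \<open>
  \<open>P\<^sub>t\<close> commutes with difference quotients in time and is a contraction, so it preserves the domain of the generator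
  and commutes with the generator, which is \<open>\<Delta>\<close>.
\<close>

lemma P_dom_Lap:
  assumes f: "f \<in> dom_Lap G" and t: "t \<ge> 0"
  shows "P t f \<in> dom_Lap G" and "Lap G (P t f) = P t (Lap G f)"
proof -
  have "((\<lambda>r. l2_norm G (\<lambda>x. (P r (P t f) x - P t f x) / r - P t (Lap G f) x)) \<longlongrightarrow> 0) (at_right 0)"
  proof (rule Lim_null_comparison[OF _ generator_limit[OF f]])
    have "norm (l2_norm G (\<lambda>x. (P r (P t f) x - P t f x) / r - P t (Lap G f) x)) \<le>
        l2_norm G (\<lambda>x. (P r f x - f x) / r - Lap G f x)" if "r > 0" for r
      using P_contraction[OF t difference_quotient_l2[OF f, of r]] that
      by (simp add: P_difference_quotient[OF f t that] l2_norm_nonneg)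
    then show "\<forall>\<^sub>F r in at_right 0. norm (l2_norm G (\<lambda>x. (P r (P t f) x - P t f x) / r - P t (Lap G f) x)) \<le>
        l2_norm G (\<lambda>x. (P r f x - f x) / r - Lap G f x)"
      using eventually_at_right_less[of "0 :: real"] by (rule eventually_mono[rotated])
  qed
  note gen = generatorI[OF P_l2 P_l2 this, OF t _ t]
  show "P t f \<in> dom_Lap G" "Lap G (P t f) = P t (Lap G f)"
    using gen f by (simp_all add: dom_Lap_l2)
qed

lemma dom_Lap_diff:
  assumes "f \<in> dom_Lap G" "g \<in> dom_Lap G"
  shows "(\<lambda>x. f x - g x) \<in> dom_Lap G"
proof (rule generatorI)
  show "(\<lambda>x. f x - g x) \<in> lp G 2" "(\<lambda>x. Lap G f x - Lap G g x) \<in> lp G 2"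
    using assms by (auto intro: l2_diff dom_Lap_l2)
  let ?e = "\<lambda>f r x. (P r f x - f x) / r - Lap G f x"
  have "((\<lambda>r. l2_norm G (?e f r) + l2_norm G (?e g r)) \<longlongrightarrow> 0 + 0) (at_right 0)"
    by (intro tendsto_add generator_limit assms)
  then have lim: "((\<lambda>r. l2_norm G (?e f r) + l2_norm G (?e g r)) \<longlongrightarrow> 0) (at_right 0)" by simp
  show "((\<lambda>r. l2_norm G (\<lambda>x. (P r (\<lambda>x. f x - g x) x - (f x - g x)) / r -
      (Lap G f x - Lap G g x))) \<longlongrightarrow> 0) (at_right 0)"
  proof (rule Lim_null_comparison[OF _ lim])
    have "norm (l2_norm G (\<lambda>x. (P r (\<lambda>x. f x - g x) x - (f x - g x)) / r -
      (Lap G f x - Lap G g x))) \<le> l2_norm G (?e f r) + l2_norm G (?e g r)" if "r > 0" for r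
    proof -
      have "(\<lambda>x. (P r (\<lambda>x. f x - g x) x - (f x - g x)) / r - (Lap G f x - Lap G g x)) =
          (\<lambda>x. ?e f r x - ?e g r x)"
        using that assms by (simp add: P_diff dom_Lap_l2 diff_divide_distrib) (simp add: algebra_simps)
      then show ?thesis
        using l2_diff(2)[OF difference_quotient_l2[OF assms(1), of r] difference_quotient_l2[OF assms(2), of r]] that
        by (simp add: l2_norm_nonneg)
    qed
    then show "\<forall>\<^sub>F r in at_right 0. norm (l2_norm G (\<lambda>x. (P r (\<lambda>x. f x - g x) x - (f x - g x)) / r -
      (Lap G f x - Lap G g x))) \<le> l2_norm G (?e f r) + l2_norm G (?e g r)"
      using eventually_at_right_less[of "0 :: real"] by (rule eventually_mono[rotated])
  qed
qed

text \<open>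
  The definition of the generator only provides derivatives from the right at time \<open>0\<close>. For a backward step of length
  \<open>r\<close> one writes the quotient as \<open>P\<^sub>t\<^sub>-\<^sub>r\<close> applied to the quotient at time \<open>0\<close> and uses that \<open>P\<^sub>t\<^sub>-\<^sub>r \<Delta>f\<close> is close to
  \<open>P\<^sub>t \<Delta>f\<close>; both errors are estimated by contractivity at time \<open>0\<close>, hence uniformly in \<open>t\<close>.
\<close>

lemma P_has_derivative:
  assumes f: "f \<in> dom_Lap G" and t: "t > 0"
  shows "((\<lambda>t. P t f x) has_real_derivative Lap G (P t f) x) (at t)"
proof -
  define g where "g = Lap G f"
  have l2: "f \<in> lp G 2" "g \<in> lp G 2" using f by (simp_all add: g_def dom_Lap_l2)
  define q where "q r = (\<lambda>x. (P r f x - f x) / r - g x)" for r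
  define e where "e r = (\<lambda>x. P r g x - g x)" for r
  define \<rho> where "\<rho> r = (l2_norm G (q r) + l2_norm G (e r)) / sqrt (meas G x)" for r
  have q_l2: "q r \<in> lp G 2" if "r > 0" for r
    using difference_quotient_l2[OF f, of r] that by (simp add: q_def g_def)
  have e_l2: "e r \<in> lp G 2" if "r > 0" for r
    using that l2 unfolding e_def by (intro l2_diff P_l2) auto
  have eval: "\<bar>P \<tau> k x\<bar> \<le> l2_norm G k / sqrt (meas G x)" if "\<tau> \<ge> 0" "k \<in> lp G 2" for \<tau> k
    using l2_eval_le[OF P_l2[OF that], of x] divide_right_mono[OF P_contraction[OF that], of "sqrt (meas G x)"]
    by (simp add: meas_nonneg)
  have q_eq: "P \<tau> (q r) x = (P (\<tau> + r) f x - P \<tau> f x) / r - P \<tau> g x" if "\<tau> \<ge> 0" "r > 0" for \<tau> r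
    using P_difference_quotient[OF f that] P_add[of r \<tau> f] that l2
    by (simp add: q_def g_def add.commute)
  have "(\<rho> \<longlongrightarrow> (0 + 0) / sqrt (meas G x)) (at_right 0)"
    unfolding \<rho>_def q_def e_def g_def
    using meas_pos[of x] by (intro tendsto_intros generator_limit f P_continuous_0 dom_Lap_l2) auto
  then have "((\<lambda>h. \<rho> \<bar>h\<bar>) \<longlongrightarrow> 0) (at 0)"
    using filterlim_compose[OF _ filterlim_abs_at_right_0] by simp
  moreover have "norm ((P (t + h) f x - P t f x) / h - P t g x) \<le> \<rho> \<bar>h\<bar>"
    if "h \<noteq> 0" "\<bar>h\<bar> < t" for h
  proof (cases "h > 0")
    case True
    have "norm ((P (t + h) f x - P t f x) / h - P t g x) \<le> l2_norm G (q h) / sqrt (meas G x)"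
      using eval[of t "q h"] q_l2 q_eq[of t h] True t by simp
    also have "\<dots> \<le> \<rho> \<bar>h\<bar>"
      using True meas_nonneg by (simp add: \<rho>_def divide_right_mono l2_norm_nonneg)
    finally show ?thesis .
  next
    case False
    define r where "r = - h"
    have r: "r > 0" "t - r \<ge> 0" "t + h = t - r" "\<bar>h\<bar> = r" "h = - r" using False that by (auto simp: r_def)
    have "P (t - r) (e r) x = P t g x - P (t - r) g x"
      using P_increment[of "t - r" r g x] r l2 by (simp add: e_def)
    moreover have "(P (t + h) f x - P t f x) / h = (P t f x - P (t - r) f x) / r"
      using r by (simp add: divide_simps)
    ultimately have "(P (t + h) f x - P t f x) / h - P t g x = P (t - r) (q r) x - P (t - r) (e r) x"
      using q_eq[of "t - r" r] r by simp
    moreover have "\<bar>P (t - r) (q r) x - P (t - r) (e r) x\<bar> \<le> \<bar>P (t - r) (q r) x\<bar> + \<bar>P (t - r) (e r) x\<bar>"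
      by (rule abs_triangle_ineq4)
    ultimately show ?thesis
      using eval[OF r(2) q_l2[OF r(1)]] eval[OF r(2) e_l2[OF r(1)]] r
      by (simp add: \<rho>_def add_divide_distrib)
  qed
  then have "\<forall>\<^sub>F h in at 0. norm ((P (t + h) f x - P t f x) / h - P t g x) \<le> \<rho> \<bar>h\<bar>"
    using t by (auto simp: eventually_at dist_real_def intro!: exI[of _ t])
  ultimately have "((\<lambda>h. (P (t + h) f x - P t f x) / h - P t g x) \<longlongrightarrow> 0) (at 0)"
    by (rule Lim_null_comparison[rotated])
  then have "((\<lambda>h. (P (t + h) f x - P t f x) / h) \<longlongrightarrow> P t g x) (at 0)"
    by (simp add: Lim_null[symmetric])
  then show ?thesis using P_dom_Lap(2)[OF f, of t] t by (simp add: DERIV_def g_def)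
qed

lemma P_continuous_on:
  assumes f: "f \<in> dom_Lap G"
  shows "continuous_on {0..} (\<lambda>t. P t f x)"
  unfolding continuous_on_eq_continuous_within
proof
  fix t :: real assume "t \<in> {0..}"
  show "continuous (at t within {0..}) (\<lambda>t. P t f x)"
  proof (cases "t = 0")
    case True
    have l2: "f \<in> lp G 2" using f by (rule dom_Lap_l2)
    have "((\<lambda>t. l2_norm G (\<lambda>x. P t f x - f x) / sqrt (meas G x)) \<longlongrightarrow> 0 / sqrt (meas G x)) (at_right 0)"
      using meas_pos[of x] by (intro tendsto_intros P_continuous_0 l2) auto
    then have lim: "((\<lambda>t. l2_norm G (\<lambda>x. P t f x - f x) / sqrt (meas G x)) \<longlongrightarrow> 0) (at_right 0)" by simp
    have "((\<lambda>t. P t f x - f x) \<longlongrightarrow> 0) (at_right 0)"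
    proof (rule Lim_null_comparison[OF _ lim])
      show "\<forall>\<^sub>F t in at_right 0. norm (P t f x - f x) \<le> l2_norm G (\<lambda>x. P t f x - f x) / sqrt (meas G x)"
        using eventually_at_right_less[of "0 :: real"]
        by eventually_elim (use l2_eval_le[OF l2_diff(1)[OF P_l2[OF _ l2] l2]] in auto)
    qed
    then have "((\<lambda>t. P t f x) \<longlongrightarrow> f x) (at_right 0)" by (simp add: Lim_null[symmetric])
    then show ?thesis
      using True l2 by (simp add: continuous_within P_0 at_within_Ici_at_right)
  next
    case False
    with \<open>t \<in> {0..}\<close> have "t > 0" by simp
    from DERIV_isCont[OF P_has_derivative[OF f this]] show ?thesis
      by (rule continuous_at_imp_continuous_at_within)
  qed
qed

section \<open>Uniform decay at infinity\<close>

lemma l2_tail: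
  assumes f: "f \<in> lp G 2" and "\<kappa> > 0"
  shows "finite {x. \<bar>f x\<bar> > \<kappa>}"
proof -
  have "finite {x. meas G x * (f x)\<^sup>2 > m_min * \<kappa>\<^sup>2}"
    by (rule finite_superlevel_set[OF _ l2_finite_sum_le[OF f]])
      (use \<open>\<kappa> > 0\<close> m_min_pos meas_nonneg in auto)
  moreover have "meas G x * (f x)\<^sup>2 > m_min * \<kappa>\<^sup>2" if "\<bar>f x\<bar> > \<kappa>" for x
  proof -
    have "\<kappa>\<^sup>2 < (f x)\<^sup>2" using that \<open>\<kappa> > 0\<close> power_strict_mono[of \<kappa> "\<bar>f x\<bar>" 2] by simp
    then have "m_min * \<kappa>\<^sup>2 < m_min * (f x)\<^sup>2" using m_min_pos by simp
    also have "\<dots> \<le> meas G x * (f x)\<^sup>2" by (rule mult_right_mono[OF m_min_le]) simp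
    finally show ?thesis .
  qed
  ultimately show ?thesis
    by (metis (mono_tags, lifting) mem_Collect_eq rev_finite_subset subsetI)
qed

lemma Gam_tail:
  assumes u: "finite_energy G u" and "\<kappa> > 0"
  shows "finite {x. Gam G u u x > \<kappa>}"
proof -
  have "finite {x. meas G x * Gam G u u x > m_min * \<kappa>}"
    by (rule finite_superlevel_set[OF _ sum_Gam_le_energy[OF u]])
      (use \<open>\<kappa> > 0\<close> m_min_pos meas_nonneg Gam_nonneg in auto)
  moreover have "meas G x * Gam G u u x > m_min * \<kappa>" if "Gam G u u x > \<kappa>" for x
  proof -
    have "m_min * \<kappa> < m_min * Gam G u u x" using m_min_pos that by simp
    also have "\<dots> \<le> meas G x * Gam G u u x" by (rule mult_right_mono[OF m_min_le Gam_nonneg])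
    finally show ?thesis .
  qed
  ultimately show ?thesis
    by (metis (mono_tags, lifting) mem_Collect_eq rev_finite_subset subsetI)
qed

lemma Gam_le_graph_norm:
  assumes u: "u \<in> dom_Lap G" and b: "l2_norm G u \<le> \<rho>" "l2_norm G (Lap G u) \<le> \<rho>"
  shows "Gam G u u x \<le> \<rho>\<^sup>2 / m_min"
proof -
  have "m_min * Gam G u u x \<le> meas G x * Gam G u u x"
    by (rule mult_right_mono[OF m_min_le Gam_nonneg])
  also have "\<dots> \<le> energy G u u"
    using sum_Gam_le_energy[OF dom_Lap_finite_energy[OF u], of "{x}"] by simp
  also have "\<dots> \<le> l2_norm G u * l2_norm G (Lap G u)" by (rule energy_le[OF u])
  also have "\<dots> \<le> \<rho> * \<rho>"
    by (intro mult_mono b l2_norm_nonneg order_trans[OF l2_norm_nonneg b(1)])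
  finally show ?thesis using m_min_pos by (simp add: field_simps power2_eq_square)
qed

lemma short_time:
  assumes f: "f \<in> lp G 2" and "\<rho> > 0"
  shows "\<exists>\<delta>>0. \<forall>r. 0 \<le> r \<and> r < \<delta> \<longrightarrow> l2_norm G (\<lambda>x. P r f x - f x) \<le> \<rho>"
proof -
  from order_tendstoD(2)[OF P_continuous_0[OF f] \<open>\<rho> > 0\<close>]
  obtain \<delta> where \<delta>: "\<delta> > 0" "\<And>r. 0 < r \<Longrightarrow> r < \<delta> \<Longrightarrow> l2_norm G (\<lambda>x. P r f x - f x) < \<rho>"
    by (auto simp: eventually_at_right_field)
  have "l2_norm G (\<lambda>x. P r f x - f x) \<le> \<rho>" if "0 \<le> r" "r < \<delta>" for r
  proof (cases "r = 0")
    case True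
    then show ?thesis using \<open>\<rho> > 0\<close> by (simp add: P_0 f l2_norm_eq)
  qed (use \<delta>(2)[of r] that in auto)
  with \<delta>(1) show ?thesis by blast
qed

text \<open>
  The orbit over \<open>[0, T]\<close> is compact in \<open>\<ell>\<^sup>2\<close>. Concretely, it stays within \<open>\<rho>\<close> of its values at finitely many grid times, since
  \<open>\<parallel>P\<^sub>t\<^sub>+\<^sub>r g - P\<^sub>t g\<parallel> \<le> \<parallel>P\<^sub>r g - g\<parallel>\<close>. Values at a point are bounded by \<open>\<ell>\<^sup>2\<close> norms because the measure is bounded below.
\<close>

lemma P_uniform_tail:
  assumes g: "g \<in> lp G 2" and "\<kappa> > 0"
  shows "\<exists>K. finite K \<and> (\<forall>\<tau>\<in>{0..T}. \<forall>x. x \<notin> K \<longrightarrow> \<bar>P \<tau> g x\<bar> \<le> \<kappa>)"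
proof -
  define \<rho> where "\<rho> = \<kappa> / 2 * sqrt m_min"
  have "\<rho> > 0" using \<open>\<kappa> > 0\<close> m_min_pos by (simp add: \<rho>_def)
  from short_time[OF g this] obtain \<delta> where \<delta>: "\<delta> > 0"
    and short: "\<And>r. 0 \<le> r \<Longrightarrow> r < \<delta> \<Longrightarrow> l2_norm G (\<lambda>x. P r g x - g x) \<le> \<rho>" by blast
  define K where "K = (\<Union>i\<le>nat \<lfloor>T / \<delta>\<rfloor>. {x. \<bar>P (real i * \<delta>) g x\<bar> > \<kappa> / 2})"
  have "finite K"
    unfolding K_def using \<delta> \<open>\<kappa> > 0\<close> by (intro finite_UN_I l2_tail P_l2 g) auto
  moreover have "\<bar>P \<tau> g x\<bar> \<le> \<kappa>" if "\<tau> \<in> {0..T}" "x \<notin> K" for \<tau> x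
  proof -
    from that obtain i r where ir: "i \<le> nat \<lfloor>T / \<delta>\<rfloor>" "0 \<le> r" "r < \<delta>" "\<tau> = real i * \<delta> + r"
      using uniform_grid[OF \<delta>, of \<tau> T] by auto
    let ?t = "real i * \<delta>"
    have t: "?t \<ge> 0" using \<delta> by simp
    have e: "(\<lambda>x. P r g x - g x) \<in> lp G 2" using ir g by (intro l2_diff P_l2)
    have "\<bar>P ?t (\<lambda>x. P r g x - g x) x\<bar> \<le> l2_norm G (P ?t (\<lambda>x. P r g x - g x)) / sqrt (meas G x)"
      by (rule l2_eval_le[OF P_l2[OF t e]])
    also have "\<dots> \<le> \<rho> / sqrt m_min"
      using P_contraction[OF t e] short[OF ir(2,3)] m_min_pos m_min_le[of x] \<open>\<rho> > 0\<close>
      by (intro frac_le) auto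
    also have "\<dots> = \<kappa> / 2" using m_min_pos by (simp add: \<rho>_def)
    finally have "\<bar>P \<tau> g x - P ?t g x\<bar> \<le> \<kappa> / 2"
      using P_increment[OF t ir(2) g, of x] ir(4) by simp
    moreover have "\<bar>P ?t g x\<bar> \<le> \<kappa> / 2" using that(2) ir(1) by (auto simp: K_def not_less)
    ultimately show ?thesis by linarith
  qed
  ultimately show ?thesis by blast
qed

text \<open>
  The same argument in the graph norm of \<open>\<Delta>\<close>: between grid times both \<open>P\<^sub>\<tau> f\<close> and \<open>\<Delta>P\<^sub>\<tau> f = P\<^sub>\<tau> \<Delta>f\<close> move by at most
  \<open>\<rho>\<close>, and the graph norm dominates \<open>\<Gamma>\<close> at every vertex by Green's formula.
\<close>

lemma Gam_P_uniform_tail: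
  assumes f: "f \<in> dom_Lap G" and "\<kappa> > 0"
  shows "\<exists>K. finite K \<and> (\<forall>\<tau>\<in>{0..T}. \<forall>x. x \<notin> K \<longrightarrow> Gam G (P \<tau> f) (P \<tau> f) x \<le> \<kappa>)"
proof -
  have l2: "f \<in> lp G 2" "Lap G f \<in> lp G 2" using f by (simp_all add: dom_Lap_l2)
  \<comment> \<open>With this \<open>\<rho>\<close>, the increment and the grid value each contribute \<open>\<kappa> / 4\<close>, doubled by the weak triangle inequality.\<close>
  define \<rho> where "\<rho> = sqrt (\<kappa> * m_min / 4)"
  have "\<rho> > 0" using \<open>\<kappa> > 0\<close> m_min_pos by (simp add: \<rho>_def)
  from short_time[OF l2(1) this] obtain \<delta>1 where \<delta>1: "\<delta>1 > 0"
    and short1: "\<And>r. 0 \<le> r \<Longrightarrow> r < \<delta>1 \<Longrightarrow> l2_norm G (\<lambda>x. P r f x - f x) \<le> \<rho>" by blast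
  from short_time[OF l2(2) \<open>\<rho> > 0\<close>] obtain \<delta>2 where \<delta>2: "\<delta>2 > 0"
    and short2: "\<And>r. 0 \<le> r \<Longrightarrow> r < \<delta>2 \<Longrightarrow> l2_norm G (\<lambda>x. P r (Lap G f) x - Lap G f x) \<le> \<rho>" by blast
  define \<delta> where "\<delta> = min \<delta>1 \<delta>2"
  have \<delta>: "\<delta> > 0" using \<delta>1 \<delta>2 by (simp add: \<delta>_def)
  define K where "K = (\<Union>i\<le>nat \<lfloor>T / \<delta>\<rfloor>. {x. Gam G (P (real i * \<delta>) f) (P (real i * \<delta>) f) x > \<kappa> / 4})"
  have "finite K"
    unfolding K_def using \<delta> \<open>\<kappa> > 0\<close>
    by (intro finite_UN_I Gam_tail dom_Lap_finite_energy P_dom_Lap(1)[OF f]) auto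
  moreover have "Gam G (P \<tau> f) (P \<tau> f) x \<le> \<kappa>" if "\<tau> \<in> {0..T}" "x \<notin> K" for \<tau> x
  proof -
    from that obtain i r where ir: "i \<le> nat \<lfloor>T / \<delta>\<rfloor>" "0 \<le> r" "r < \<delta>" "\<tau> = real i * \<delta> + r"
      using uniform_grid[OF \<delta>, of \<tau> T] by auto
    let ?t = "real i * \<delta>"
    define b where "b = (\<lambda>x. P \<tau> f x - P ?t f x)"
    have t: "?t \<ge> 0" and \<tau>: "\<tau> \<ge> 0" using \<delta> that by auto
    have b_dom: "b \<in> dom_Lap G" unfolding b_def by (intro dom_Lap_diff P_dom_Lap(1)[OF f] t \<tau>)
    have b_eq: "b = P ?t (\<lambda>x. P r f x - f x)"
      using P_increment[OF t ir(2) l2(1)] ir(4) by (auto simp: b_def)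
    have Lap_b: "Lap G b = P ?t (\<lambda>x. P r (Lap G f) x - Lap G f x)"
    proof
      fix x
      show "Lap G b x = P ?t (\<lambda>x. P r (Lap G f) x - Lap G f x) x"
        unfolding b_def Lap_diff P_dom_Lap(2)[OF f t] P_dom_Lap(2)[OF f \<tau>]
        using P_increment[OF t ir(2) l2(2)] ir(4) by simp
    qed
    have "l2_norm G b \<le> l2_norm G (\<lambda>x. P r f x - f x)"
      unfolding b_eq using ir l2 by (intro P_contraction t l2_diff P_l2)
    also have "\<dots> \<le> \<rho>" using short1[of r] ir by (simp add: \<delta>_def)
    finally have b1: "l2_norm G b \<le> \<rho>" .
    have "l2_norm G (Lap G b) \<le> l2_norm G (\<lambda>x. P r (Lap G f) x - Lap G f x)"
      unfolding Lap_b using ir l2 by (intro P_contraction t l2_diff P_l2)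
    also have "\<dots> \<le> \<rho>" using short2[of r] ir by (simp add: \<delta>_def)
    finally have b2: "l2_norm G (Lap G b) \<le> \<rho>" .
    have "Gam G b b x \<le> \<kappa> / 4"
      using Gam_le_graph_norm[OF b_dom b1 b2, of x] \<open>\<kappa> > 0\<close> m_min_pos by (simp add: \<rho>_def)
    moreover have "Gam G (P ?t f) (P ?t f) x \<le> \<kappa> / 4"
      using that(2) ir(1) by (auto simp: K_def not_less)
    ultimately show ?thesis
      using Gam_diff_le[of "P \<tau> f" x "P ?t f"] unfolding b_def by linarith
  qed
  ultimately show ?thesis by blast
qed

end


section \<open>Maximum principle and curvature\<close>

context weighted_graph
begin

lemma Lap_le_0_at_max:
  assumes "\<And>y. g y \<le> g x"
  shows "Lap G g x \<le> 0"
proof -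
  have "meas G x * Lap G g x \<le> 0"
    unfolding meas_mult_Lap using assms by (intro sum_nonpos mult_nonneg_nonpos wt_nonneg) simp
  then show ?thesis using meas_pos[of x] by (simp add: mult_le_0_iff)
qed

text \<open>
  If \<open>w\<close> had a positive value, then \<open>w - \<delta> \<tau>\<close> would still have one for small \<open>\<delta>\<close>. By the decay at infinity its supremum
  over all vertices and times in \<open>[0, T]\<close> is attained, at a positive time. There \<open>\<partial>\<^sub>\<tau> w \<ge> \<delta> > 0 \<ge> \<Delta>w\<close>, a contradiction.
\<close>

lemma maximum_principle:
  fixes w w' :: "real \<Rightarrow> 'v \<Rightarrow> real"
  assumes cont: "\<And>x. continuous_on {0..T} (\<lambda>\<tau>. w \<tau> x)"
    and deriv: "\<And>\<tau> x. 0 < \<tau> \<Longrightarrow> \<tau> \<le> T \<Longrightarrow> ((\<lambda>\<tau>. w \<tau> x) has_real_derivative w' \<tau> x) (at \<tau>)"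
    and sub: "\<And>\<tau> x. 0 < \<tau> \<Longrightarrow> \<tau> \<le> T \<Longrightarrow> w' \<tau> x \<le> Lap G (w \<tau>) x"
    and init: "\<And>x. w 0 x \<le> 0"
    and tail: "\<And>\<kappa>. \<kappa> > 0 \<Longrightarrow> \<exists>K. finite K \<and> (\<forall>\<tau>\<in>{0..T}. \<forall>x. x \<notin> K \<longrightarrow> w \<tau> x \<le> \<kappa>)"
    and \<tau>0: "0 \<le> \<tau>0" "\<tau>0 \<le> T"
  shows "w \<tau>0 x0 \<le> 0"
proof (rule ccontr)
  assume "\<not> ?thesis"
  then have pos: "w \<tau>0 x0 > 0" by simp
  with init[of x0] \<tau>0 have "\<tau>0 > 0" by (cases "\<tau>0 = 0") auto
  with \<tau>0 have T: "T > 0" by simp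
  define \<kappa> where "\<kappa> = w \<tau>0 x0"
  \<comment> \<open>The tilt costs at most half of the value \<open>\<kappa>\<close>, so the tilted maximum stays above the bound \<open>\<kappa> / 4\<close> near infinity.\<close>
  define \<delta> where "\<delta> = \<kappa> / (2 * T)"
  define h where "h \<tau> x = w \<tau> x - \<delta> * \<tau>" for \<tau> x
  have \<kappa>: "\<kappa> > 0" and \<delta>: "\<delta> > 0" using pos T by (simp_all add: \<kappa>_def \<delta>_def)
  from tail[of "\<kappa> / 4"] \<kappa> obtain K where K: "finite K"
    and small: "\<And>\<tau> x. \<tau> \<in> {0..T} \<Longrightarrow> x \<notin> K \<Longrightarrow> w \<tau> x \<le> \<kappa> / 4" by auto
  have "\<delta> * \<tau>0 \<le> \<kappa> / 2"
    using \<tau>0 T \<kappa> mult_left_mono[OF \<tau>0(2), of \<delta>] \<delta> by (simp add: \<delta>_def)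
  then have h0: "h \<tau>0 x0 \<ge> \<kappa> / 2" by (simp add: h_def \<kappa>_def)
  have "\<exists>\<tau>\<in>{0..T}. \<forall>\<sigma>\<in>{0..T}. h \<sigma> x \<le> h \<tau> x" for x
    unfolding h_def using T
    by (intro continuous_attains_sup continuous_intros cont) auto
  then obtain m where m: "\<And>x. m x \<in> {0..T}" "\<And>x \<sigma>. \<sigma> \<in> {0..T} \<Longrightarrow> h \<sigma> x \<le> h (m x) x"
    by metis
  define B where "B = insert x0 K"
  have B: "finite B" "B \<noteq> {}" using K by (auto simp: B_def)
  have "Max ((\<lambda>x. h (m x) x) ` B) \<in> (\<lambda>x. h (m x) x) ` B"
    by (rule Max_in) (use B in auto)
  then obtain x1 where x1_max: "Max ((\<lambda>x. h (m x) x) ` B) = h (m x1) x1" by blast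
  define \<tau>1 where "\<tau>1 = m x1"
  have x1: "h (m x) x \<le> h \<tau>1 x1" if "x \<in> B" for x
    unfolding \<tau>1_def x1_max[symmetric] using B that by (intro Max_ge) auto
  have h1: "h \<tau>1 x1 \<ge> \<kappa> / 2"
    using h0 m(2)[of \<tau>0 x0] x1[of x0] \<tau>0 by (simp add: B_def)
  have max: "h \<sigma> x \<le> h \<tau>1 x1" if "\<sigma> \<in> {0..T}" for \<sigma> x
  proof (cases "x \<in> B")
    case True
    then show ?thesis using m(2)[OF that, of x] x1 by force
  next
    case False
    have "\<delta> * \<sigma> \<ge> 0" using \<delta> that by simp
    then have "h \<sigma> x \<le> \<kappa> / 4" using False small[OF that, of x] by (simp add: h_def B_def)
    then show ?thesis using h1 \<kappa> by linarith
  qed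
  have \<tau>1: "\<tau>1 \<in> {0..T}" using m(1) by (simp add: \<tau>1_def)
  have "\<tau>1 \<noteq> 0"
  proof
    assume "\<tau>1 = 0"
    then show False using h1 init[of x1] \<kappa> by (simp add: h_def)
  qed
  with \<tau>1 have \<tau>1': "0 < \<tau>1" "\<tau>1 \<le> T" by auto
  have "Lap G (w \<tau>1) x1 \<le> 0"
    by (rule Lap_le_0_at_max) (use max[OF \<tau>1] in \<open>simp add: h_def\<close>)
  with sub[OF \<tau>1', of x1] have "w' \<tau>1 x1 - \<delta> < 0" using \<delta> by linarith
  moreover have "((\<lambda>\<tau>. h \<tau> x1) has_real_derivative w' \<tau>1 x1 - \<delta>) (at \<tau>1)"
    unfolding h_def by (auto intro!: derivative_eq_intros deriv[OF \<tau>1'])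
  ultimately obtain d where d: "d > 0" "\<And>r. r > 0 \<Longrightarrow> r < d \<Longrightarrow> h \<tau>1 x1 < h (\<tau>1 - r) x1"
    using DERIV_neg_dec_left by blast
  define r where "r = min d \<tau>1 / 2"
  have "r > 0" "r < d" "\<tau>1 - r \<in> {0..T}" using d(1) \<tau>1' by (auto simp: r_def min_def)
  with d(2)[of r] max[of "\<tau>1 - r" x1] show False by simp
qed

lemma Lap_has_derivative:
  assumes "\<And>y. ((\<lambda>\<tau>. u \<tau> y) has_real_derivative u' y) (at \<tau>)"
  shows "((\<lambda>\<tau>. Lap G (u \<tau>) x) has_real_derivative Lap G u' x) (at \<tau>)"
  unfolding Lap_def
  by (rule DERIV_cmult DERIV_sum DERIV_diff assms)+

lemma Gam_has_derivative:
  assumes "\<And>y. ((\<lambda>\<tau>. v \<tau> y) has_real_derivative v' y) (at \<tau>)"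
  shows "((\<lambda>\<tau>. Gam G (v \<tau>) (v \<tau>) x) has_real_derivative 2 * Gam G (v \<tau>) v' x) (at \<tau>)"
proof -
  have "((\<lambda>\<tau>. \<Sum>y\<in>nbrs G x. wt G x y * (v \<tau> y - v \<tau> x) * (v \<tau> y - v \<tau> x)) has_real_derivative
      (\<Sum>y\<in>nbrs G x. 2 * (wt G x y * (v \<tau> y - v \<tau> x) * (v' y - v' x)))) (at \<tau>)"
    by (rule DERIV_sum) (auto intro!: derivative_eq_intros assms)
  from DERIV_cmult[OF this, of "1 / (2 * meas G x)"] show ?thesis
    by (simp add: Gam_def sum_distrib_left[symmetric])
qed

lemma Lap_power2: "Lap G (\<lambda>y. (v y)\<^sup>2) x = 2 * v x * Lap G v x + 2 * Gam G v v x"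
proof -
  have "meas G x * Lap G (\<lambda>y. (v y)\<^sup>2) x =
      (\<Sum>y\<in>nbrs G x. 2 * v x * (wt G x y * (v y - v x)) + wt G x y * (v y - v x)\<^sup>2)"
    unfolding meas_mult_Lap by (intro sum.cong refl) (simp add: power2_eq_square algebra_simps)
  also have "\<dots> = 2 * v x * (meas G x * Lap G v x) + 2 * (meas G x * Gam G v v x)"
    by (simp add: meas_mult_Lap meas_mult_Gam sum.distrib sum_distrib_left[symmetric])
  also have "\<dots> = meas G x * (2 * v x * Lap G v x + 2 * Gam G v v x)"
    by (simp add: algebra_simps)
  finally show ?thesis using meas_pos[of x] by simp
qed

lemma Lap_ln_le:
  assumes v: "\<And>y. v y > 0"
  shows "v x * Lap G (\<lambda>y. ln (v y)) x \<le> Lap G v x"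
proof -
  have "wt G x y * (v x * (ln (v y) - ln (v x))) \<le> wt G x y * (v y - v x)" for y
  proof (rule mult_left_mono[OF _ wt_nonneg])
    have "ln (v y) - ln (v x) \<le> v y / v x - 1"
      using ln_le_minus_one[of "v y / v x"] v[of x] v[of y] by (simp add: ln_div)
    then show "v x * (ln (v y) - ln (v x)) \<le> v y - v x"
      using v[of x] mult_left_mono[of "ln (v y) - ln (v x)" "v y / v x - 1" "v x"]
      by (simp add: right_diff_distrib)
  qed
  then have "(\<Sum>y\<in>nbrs G x. wt G x y * (v x * (ln (v y) - ln (v x)))) \<le> meas G x * Lap G v x"
    unfolding meas_mult_Lap by (rule sum_mono)
  moreover have "(\<Sum>y\<in>nbrs G x. wt G x y * (v x * (ln (v y) - ln (v x)))) =
      meas G x * (v x * Lap G (\<lambda>y. ln (v y)) x)"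
    unfolding mult.left_commute[of "meas G x"] meas_mult_Lap by (simp add: sum_distrib_left mult.left_commute)
  ultimately show ?thesis using meas_pos[of x] by simp
qed

text \<open>
  The curvature condition bounds \<open>\<Gamma>\<close>-tilde-two by \<open>v\<^sup>2 L\<^sup>2 / n\<close> with \<open>L = \<Delta> ln v\<close>. Replacing \<open>L\<^sup>2\<close> by its tangent
  \<open>2 \<gamma> L - \<gamma>\<^sup>2\<close> makes the bound linear in \<open>L\<close>, and \<open>\<gamma> \<le> 0\<close> allows the use of the upper bound \<open>v L \<le> \<Delta>v\<close>, where
  \<open>2 v \<Delta>v = \<Delta>(v\<^sup>2) - 2 \<Gamma>(v)\<close>. The result involves no logarithm.
\<close>

lemma CDE'_linearized:
  assumes CDE: "CDE' G n 0" and n: "n > 0" and v: "\<And>y. v y > 0" and \<gamma>: "\<gamma> \<le> 0"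
  shows "n * Gam2_tilde G v x \<ge>
    \<gamma> * (Lap G (\<lambda>y. (v y)\<^sup>2) x - 2 * Gam G v v x) - \<gamma>\<^sup>2 * (v x)\<^sup>2"
proof -
  define L where "L = Lap G (\<lambda>y. ln (v y)) x"
  have "Gam2_tilde G v x \<ge> 1 / n * (v x)\<^sup>2 * L\<^sup>2"
    using CDE v by (auto simp: CDE'_def L_def)
  then have "n * Gam2_tilde G v x \<ge> (v x)\<^sup>2 * L\<^sup>2"
    using n by (simp add: field_simps)
  moreover have "(v x)\<^sup>2 * L\<^sup>2 \<ge> 2 * \<gamma> * ((v x)\<^sup>2 * L) - \<gamma>\<^sup>2 * (v x)\<^sup>2"
  proof -
    have "0 \<le> (v x * (L - \<gamma>))\<^sup>2" by simp
    then show ?thesis by (simp add: power2_eq_square algebra_simps)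
  qed
  moreover have "2 * \<gamma> * ((v x)\<^sup>2 * L) \<ge> 2 * \<gamma> * (v x * Lap G v x)"
  proof (rule mult_left_mono_neg)
    show "(v x)\<^sup>2 * L \<le> v x * Lap G v x"
      using mult_left_mono[OF Lap_ln_le[of v x, OF v], of "v x"] v[of x]
      by (simp add: L_def power2_eq_square mult.assoc)
  qed (use \<gamma> in simp)
  moreover have "2 * \<gamma> * (v x * Lap G v x) = \<gamma> * (Lap G (\<lambda>y. (v y)\<^sup>2) x - 2 * Gam G v v x)"
    by (simp add: Lap_power2)
  ultimately show ?thesis by linarith
qed

text \<open>
  Away from \<open>0\<close> the square root is Lipschitz; the shift by \<open>\<epsilon>\<close> thus transfers the decay of \<open>\<Gamma>(u)\<close> at infinity to the
  square root.
\<close>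

lemma Gam_sqrt_le:
  assumes u: "\<And>y. u y \<ge> 0" and \<epsilon>: "\<epsilon> > 0"
  shows "Gam G (\<lambda>y. sqrt (u y + \<epsilon>)) (\<lambda>y. sqrt (u y + \<epsilon>)) x \<le> Gam G u u x / (4 * \<epsilon>)"
proof -
  have "(sqrt (u y + \<epsilon>) - sqrt (u x + \<epsilon>))\<^sup>2 \<le> (u y - u x)\<^sup>2 / (4 * \<epsilon>)" for y
  proof -
    define p q where "p = sqrt (u y + \<epsilon>)" and "q = sqrt (u x + \<epsilon>)"
    have pq: "p \<ge> sqrt \<epsilon>" "q \<ge> sqrt \<epsilon>" using u by (simp_all add: p_def q_def)
    have "(2 * sqrt \<epsilon>)\<^sup>2 \<le> (p + q)\<^sup>2"
      by (rule power_mono) (use pq \<epsilon> in auto)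
    then have "4 * \<epsilon> \<le> (p + q)\<^sup>2" using \<epsilon> by (simp add: power_mult_distrib)
    then have "(p - q)\<^sup>2 * (4 * \<epsilon>) \<le> (p - q)\<^sup>2 * (p + q)\<^sup>2"
      by (rule mult_left_mono) simp
    also have "\<dots> = (p\<^sup>2 - q\<^sup>2)\<^sup>2" by (simp add: power2_eq_square algebra_simps)
    also have "p\<^sup>2 - q\<^sup>2 = u y - u x" using u[of x] u[of y] \<epsilon> by (simp add: p_def q_def)
    finally show ?thesis using \<epsilon> by (simp add: p_def q_def field_simps)
  qed
  then have "(\<Sum>y\<in>nbrs G x. wt G x y * (sqrt (u y + \<epsilon>) - sqrt (u x + \<epsilon>))\<^sup>2) \<le>
      (\<Sum>y\<in>nbrs G x. wt G x y * ((u y - u x)\<^sup>2 / (4 * \<epsilon>)))"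
    by (intro sum_mono mult_left_mono wt_nonneg)
  then have "meas G x * Gam G (\<lambda>y. sqrt (u y + \<epsilon>)) (\<lambda>y. sqrt (u y + \<epsilon>)) x \<le>
      meas G x * (Gam G u u x / (4 * \<epsilon>))"
    unfolding times_divide_eq_right meas_mult_Gam by (simp add: sum_divide_distrib[symmetric] field_simps)
  then show ?thesis by (rule mult_left_le_imp_le[OF _ meas_pos])
qed

lemma Gam_ge_edge:
  assumes "(x, y) \<in> edges G"
  shows "2 * Gam G v v x \<ge> wt G x y / meas G x * (v y - v x)\<^sup>2"
proof -
  have "wt G x y * (v y - v x)\<^sup>2 \<le> (\<Sum>y\<in>nbrs G x. wt G x y * (v y - v x)\<^sup>2)"
    by (rule member_le_sum) (use assms locally_finite wt_nonneg in \<open>auto simp: nbrs_iff\<close>)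
  then have "wt G x y * (v y - v x)\<^sup>2 \<le> meas G x * (2 * Gam G v v x)"
    using meas_mult_Gam[of x v] by simp
  then show ?thesis using meas_pos[of x] by (simp add: field_simps)
qed

end

section \<open>The Li--Yau inequality\<close>

context heat_flow
begin

text \<open>
  The maximum principle applies to \<open>P\<^sub>\<tau> f - c\<close>: its positive part decays at infinity because \<open>c \<ge> 0\<close> and \<open>P\<^sub>\<tau> f\<close> decays.
\<close>

lemma P_le_const:
  assumes f: "f \<in> dom_Lap G" and c: "c \<ge> 0" "\<And>x. f x \<le> c" and \<tau>: "\<tau> \<ge> 0"
  shows "P \<tau> f x \<le> c"
proof -
  have "P \<tau> f x - c \<le> 0"
  proof (rule maximum_principle[where T = \<tau> and w = "\<lambda>\<tau> x. P \<tau> f x - c" and w' = "\<lambda>\<tau>. Lap G (P \<tau> f)"])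
    show "continuous_on {0..\<tau>} (\<lambda>\<tau>. P \<tau> f x - c)" for x
      by (intro continuous_intros continuous_on_subset[OF P_continuous_on[OF f]]) auto
    show "((\<lambda>\<tau>. P \<tau> f x - c) has_real_derivative Lap G (P \<tau>' f) x) (at \<tau>')" if "0 < \<tau>'" for \<tau>' x
      by (auto intro!: derivative_eq_intros P_has_derivative[OF f that])
    show "\<exists>K. finite K \<and> (\<forall>\<tau>\<in>{0..\<tau>}. \<forall>x. x \<notin> K \<longrightarrow> P \<tau> f x - c \<le> \<kappa>)" if \<kappa>: "\<kappa> > 0" for \<kappa>
    proof -
      from P_uniform_tail[OF dom_Lap_l2(1)[OF f] \<kappa>, of \<tau>] obtain K where
        "finite K" "\<forall>\<tau>\<in>{0..\<tau>}. \<forall>x. x \<notin> K \<longrightarrow> \<bar>P \<tau> f x\<bar> \<le> \<kappa>" by blast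
      with c(1) show ?thesis by (intro exI[of _ K]) force
    qed
    show "P 0 f x - c \<le> 0" for x using c(2) by (simp add: P_0 dom_Lap_l2[OF f])
  qed (use \<tau> Lap_diff_const in auto)
  then show ?thesis by simp
qed

lemma P_nonneg:
  assumes f: "f \<in> dom_Lap G" "\<And>x. f x \<ge> 0" and \<tau>: "\<tau> \<ge> 0"
  shows "P \<tau> f x \<ge> 0"
proof -
  have l2: "f \<in> lp G 2" using f by (simp add: dom_Lap_l2)
  have zero: "(\<lambda>x :: 'v. 0 :: real) \<in> dom_Lap G" by (rule C0_dom_Lap) (simp add: C0_def)
  have "P \<tau> (\<lambda>x. 0) = (\<lambda>x. 0)" using P_scale[OF \<tau> l2, of 0] by simp
  moreover have "P \<tau> (\<lambda>x. 0 - f x) x \<le> 0"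
    by (rule P_le_const[OF dom_Lap_diff[OF zero f(1)]]) (use f \<tau> in auto)
  ultimately show ?thesis using P_diff[OF \<tau> dom_Lap_l2(1)[OF zero] l2] by simp
qed

text \<open>
  The function \<open>w\<close> below is \<open>\<tau>\<^sup>2\<close> times the difference of the two sides, at time \<open>\<tau>\<close>. The factor removes the singularity at
  \<open>\<tau> = 0\<close> and makes \<open>w\<close> vanish there. The term \<open>2 \<tau> \<Gamma>(v)\<close>, which comes from differentiating the factor, is cancelled by
  the term \<open>- 2 \<gamma> \<Gamma>(v)\<close> of \<open>CDE'_linearized\<close> exactly when \<open>\<gamma> = - n / (2\<tau>)\<close>.
\<close>

lemma Li_Yau:
  assumes CDE: "CDE' G n 0" and n: "n > 0"
    and f: "f \<in> dom_Lap G" "\<And>x. f x \<ge> 0" and \<epsilon>: "\<epsilon> > 0" and T: "T > 0"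
  shows "Gam G (\<lambda>y. sqrt (P T f y + \<epsilon>)) (\<lambda>y. sqrt (P T f y + \<epsilon>)) x \<le>
    Lap G (P T f) x / 2 + n / (2 * T) * (P T f x + \<epsilon>)"
proof -
  define v where "v \<tau> y = sqrt (P \<tau> f y + \<epsilon>)" for \<tau> y
  define v' where "v' \<tau> y = Lap G (P \<tau> f) y / (2 * v \<tau> y)" for \<tau> y
  define g where "g \<tau> = Gam G (v \<tau>) (v \<tau>)" for \<tau>
  define w where "w \<tau> y = \<tau>\<^sup>2 * g \<tau> y - \<tau>\<^sup>2 / 2 * Lap G (P \<tau> f) y - n / 2 * \<tau> * (P \<tau> f y + \<epsilon>)" for \<tau> y
  define w' where "w' \<tau> y = (2 * \<tau> * g \<tau> y + \<tau>\<^sup>2 * (2 * Gam G (v \<tau>) (v' \<tau>) y)) -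
      (\<tau> * Lap G (P \<tau> f) y + \<tau>\<^sup>2 / 2 * Lap G (Lap G (P \<tau> f)) y) -
      (n / 2 * (P \<tau> f y + \<epsilon>) + n / 2 * \<tau> * Lap G (P \<tau> f) y)" for \<tau> y
  have u0: "P \<tau> f y \<ge> 0" if "\<tau> \<ge> 0" for \<tau> y by (rule P_nonneg[OF f that])
  have v0: "v \<tau> y > 0" and v_sq: "(v \<tau> y)\<^sup>2 = P \<tau> f y + \<epsilon>" if "\<tau> \<ge> 0" for \<tau> y
    using u0[OF that, of y] \<epsilon> by (simp_all add: v_def)
  have v_deriv: "((\<lambda>\<tau>. v \<tau> y) has_real_derivative v' \<tau> y) (at \<tau>)" if "\<tau> > 0" for \<tau> y
  proof -
    have "P \<tau> f y + \<epsilon> > 0" using u0[of \<tau> y] \<epsilon> that by simp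
    then show ?thesis
      unfolding v_def v'_def
      by (auto intro!: derivative_eq_intros P_has_derivative[OF f(1) that] simp: field_simps)
  qed
  have P_cont: "continuous_on {0..T} (\<lambda>\<tau>. P \<tau> f y)" for y
    by (rule continuous_on_subset[OF P_continuous_on[OF f(1)]]) auto
  have "w T x \<le> 0"
  proof (rule maximum_principle[where T = T and w = w and w' = w'])
    show "continuous_on {0..T} (\<lambda>\<tau>. w \<tau> y)" for y
      unfolding w_def g_def v_def Gam_def Lap_def by (intro continuous_intros P_cont) auto
    show "((\<lambda>\<tau>. w \<tau> y) has_real_derivative w' \<tau> y) (at \<tau>)" if \<tau>: "0 < \<tau>" for \<tau> y
    proof -
      have "((\<lambda>\<tau>. g \<tau> y) has_real_derivative 2 * Gam G (v \<tau>) (v' \<tau>) y) (at \<tau>)"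
        unfolding g_def by (rule Gam_has_derivative[OF v_deriv[OF \<tau>]])
      moreover have "((\<lambda>\<tau>. Lap G (P \<tau> f) y) has_real_derivative Lap G (Lap G (P \<tau> f)) y) (at \<tau>)"
        by (rule Lap_has_derivative[OF P_has_derivative[OF f(1) \<tau>]])
      ultimately show ?thesis
        unfolding w_def w'_def
        by (auto intro!: derivative_eq_intros P_has_derivative[OF f(1) \<tau>] simp: field_simps)
    qed
    show "w' \<tau> y \<le> Lap G (w \<tau>) y" if \<tau>: "0 < \<tau>" for \<tau> y
    proof -
      \<comment> \<open>This choice makes the terms containing \<open>\<Gamma>(v)\<close>, \<open>\<Delta>u\<close> and \<open>u\<close> cancel simultaneously.\<close>
      define \<gamma> where "\<gamma> = - n / (2 * \<tau>)"
      have \<gamma>: "\<gamma> \<le> 0" "\<gamma> * \<tau> = - n / 2" using n \<tau> by (simp_all add: \<gamma>_def)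
      have Lap_w: "Lap G (w \<tau>) y = \<tau>\<^sup>2 * Lap G (g \<tau>) y - \<tau>\<^sup>2 / 2 * Lap G (Lap G (P \<tau> f)) y -
          n / 2 * \<tau> * Lap G (P \<tau> f) y"
        unfolding w_def Lap_diff Lap_scale Lap_add_const ..
      have Lap_v: "Lap G (\<lambda>z. (v \<tau> z)\<^sup>2) = Lap G (P \<tau> f)"
        using v_sq[of \<tau>] \<tau> by (auto simp: Lap_add_const)
      have "Gam2_tilde G (v \<tau>) y = Lap G (g \<tau>) y / 2 - Gam G (v \<tau>) (v' \<tau>) y"
        unfolding Gam2_tilde_def Lap_v v'_def g_def by simp
      moreover have "n * Gam2_tilde G (v \<tau>) y \<ge>
          \<gamma> * (Lap G (P \<tau> f) y - 2 * g \<tau> y) - \<gamma>\<^sup>2 * (P \<tau> f y + \<epsilon>)"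
        using CDE'_linearized[of n "v \<tau>" \<gamma> y, OF CDE n _ \<gamma>(1)] v0[of \<tau>] \<tau>
        unfolding Lap_v g_def by (simp add: v_sq)
      ultimately have "2 * \<tau>\<^sup>2 / n * (\<gamma> * (Lap G (P \<tau> f) y - 2 * g \<tau> y) - \<gamma>\<^sup>2 * (P \<tau> f y + \<epsilon>)) \<le>
          2 * \<tau>\<^sup>2 / n * (n * (Lap G (g \<tau>) y / 2 - Gam G (v \<tau>) (v' \<tau>) y))"
        using n by (intro mult_left_mono) auto
      also have "2 * \<tau>\<^sup>2 / n * (n * (Lap G (g \<tau>) y / 2 - Gam G (v \<tau>) (v' \<tau>) y)) =
          \<tau>\<^sup>2 * Lap G (g \<tau>) y - \<tau>\<^sup>2 * (2 * Gam G (v \<tau>) (v' \<tau>) y)"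
        using n by (simp add: field_simps)
      also have "2 * \<tau>\<^sup>2 / n * (\<gamma> * (Lap G (P \<tau> f) y - 2 * g \<tau> y) - \<gamma>\<^sup>2 * (P \<tau> f y + \<epsilon>)) =
          - \<tau> * (Lap G (P \<tau> f) y - 2 * g \<tau> y) - n / 2 * (P \<tau> f y + \<epsilon>)"
      proof -
        have "2 * \<tau>\<^sup>2 / n * (\<gamma> * A - \<gamma>\<^sup>2 * B) = - \<tau> * A - n / 2 * B" for A B
          using n \<tau> by (simp add: \<gamma>_def field_simps power2_eq_square)
        then show ?thesis .
      qed
      finally show ?thesis unfolding Lap_w w'_def by (simp add: algebra_simps)
    qed
    show "w 0 y \<le> 0" for y by (simp add: w_def)
    show "\<exists>K. finite K \<and> (\<forall>\<tau>\<in>{0..T}. \<forall>y. y \<notin> K \<longrightarrow> w \<tau> y \<le> \<kappa>)" if \<kappa>: "\<kappa> > 0" for \<kappa>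
    proof -
      \<comment> \<open>After division by \<open>4\<epsilon>\<close> the bound on \<open>\<Gamma>\<close> contributes \<open>\<kappa> / 2\<close> to \<open>w\<close>, as does \<open>\<tau>\<^sup>2 \<Delta>u / 2\<close>; the last term of \<open>w\<close> is nonpositive.\<close>
      have c1: "2 * \<epsilon> * \<kappa> / T\<^sup>2 > 0" and c2: "\<kappa> / T\<^sup>2 > 0" using \<kappa> \<epsilon> T by simp_all
      from Gam_P_uniform_tail[OF f(1) c1, of T] obtain K1 where K1: "finite K1"
        "\<And>\<tau> y. \<tau> \<in> {0..T} \<Longrightarrow> y \<notin> K1 \<Longrightarrow> Gam G (P \<tau> f) (P \<tau> f) y \<le> 2 * \<epsilon> * \<kappa> / T\<^sup>2" by blast
      from P_uniform_tail[OF dom_Lap_l2(2)[OF f(1)] c2, of T] obtain K2 where K2: "finite K2"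
        "\<And>\<tau> y. \<tau> \<in> {0..T} \<Longrightarrow> y \<notin> K2 \<Longrightarrow> \<bar>P \<tau> (Lap G f) y\<bar> \<le> \<kappa> / T\<^sup>2" by blast
      have "w \<tau> y \<le> \<kappa>" if \<tau>: "\<tau> \<in> {0..T}" and y: "y \<notin> K1 \<union> K2" for \<tau> y
      proof -
        have \<tau>0: "\<tau> \<ge> 0" and \<tau>T: "\<tau>\<^sup>2 \<le> T\<^sup>2" using \<tau> by (auto intro: power_mono)
        have "g \<tau> y \<le> Gam G (P \<tau> f) (P \<tau> f) y / (4 * \<epsilon>)"
          unfolding g_def v_def by (rule Gam_sqrt_le[OF u0[OF \<tau>0] \<epsilon>])
        also have "\<dots> \<le> (2 * \<epsilon> * \<kappa> / T\<^sup>2) / (4 * \<epsilon>)"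
          using K1(2)[OF \<tau>, of y] y \<epsilon> by (intro divide_right_mono) auto
        also have "\<dots> = \<kappa> / T\<^sup>2 / 2" using \<epsilon> by simp
        finally have g: "g \<tau> y \<le> \<kappa> / T\<^sup>2 / 2" .
        have L: "- Lap G (P \<tau> f) y \<le> \<kappa> / T\<^sup>2"
          using K2(2)[OF \<tau>, of y] y P_dom_Lap(2)[OF f(1) \<tau>0] by simp
        have "w \<tau> y \<le> \<tau>\<^sup>2 * g \<tau> y - \<tau>\<^sup>2 / 2 * Lap G (P \<tau> f) y"
          using n \<tau>0 u0[OF \<tau>0, of y] \<epsilon> by (simp add: w_def)
        also have "\<dots> = \<tau>\<^sup>2 * (g \<tau> y + - Lap G (P \<tau> f) y / 2)" by (simp add: algebra_simps)
        also have "\<dots> \<le> \<tau>\<^sup>2 * (\<kappa> / T\<^sup>2)"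
          by (rule mult_left_mono) (use g L in auto)
        also have "\<dots> \<le> T\<^sup>2 * (\<kappa> / T\<^sup>2)"
          by (rule mult_right_mono[OF \<tau>T]) (use c2 in simp)
        also have "\<dots> = \<kappa>" using T by simp
        finally show ?thesis .
      qed
      with K1(1) K2(1) show ?thesis by (intro exI[of _ "K1 \<union> K2"]) auto
    qed
  qed (use T in auto)
  have "T\<^sup>2 * g T x \<le> T\<^sup>2 * (Lap G (P T f) x / 2 + n / (2 * T) * (P T f x + \<epsilon>))"
  proof -
    have "T\<^sup>2 * (Lap G (P T f) x / 2 + n / (2 * T) * (P T f x + \<epsilon>)) =
        T\<^sup>2 / 2 * Lap G (P T f) x + n / 2 * T * (P T f x + \<epsilon>)"
      using T by (simp add: power2_eq_square field_simps)
    with \<open>w T x \<le> 0\<close> show ?thesis unfolding w_def by linarith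
  qed
  then have "g T x \<le> Lap G (P T f) x / 2 + n / (2 * T) * (P T f x + \<epsilon>)"
    by (rule mult_left_le_imp_le) (use T in simp)
  then show ?thesis unfolding g_def v_def .
qed

end


section \<open>The Harnack inequality\<close>

context weighted_graph
begin

lemma w_min_le: "(x, y) \<in> edges G \<Longrightarrow> w_min G \<le> wt G x y"
  unfolding w_min_def
  using cINF_lower[of "\<lambda>(x, y). wt G x y" "edges G" "(x, y)"] wt_nonneg
  by (force intro!: bdd_belowI2[where m = 0])

lemma meas_le_m_max: "bdd_above (range (meas G)) \<Longrightarrow> meas G x \<le> m_max G"
  unfolding m_max_def by (rule cSUP_upper) auto

end

text \<open>
  The data of one positive solution \<open>u = P\<^sub>\<tau> f + \<epsilon>\<close> of the heat equation.
\<close>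

locale Li_Yau_flow = heat_flow G P
  for G :: "'v wgraph" and P :: "real \<Rightarrow> ('v \<Rightarrow> real) \<Rightarrow> 'v \<Rightarrow> real" +
  fixes n :: real and f :: "'v \<Rightarrow> real" and \<epsilon> :: real
  assumes CDE: "CDE' G n 0" and n_pos: "n > 0"
    and f_dom: "f \<in> dom_Lap G" and f_nonneg: "f x \<ge> 0" and \<epsilon>_pos: "\<epsilon> > 0"
    and w_min_pos: "w_min G > 0" and meas_bdd: "bdd_above (range (meas G))"
begin

text \<open>
  The summand \<open>n ln \<tau>\<close> absorbs the term \<open>n / \<tau>\<close> of the Li--Yau inequality, so that the sum is nondecreasing in time.
\<close>

definition log_flow :: "real \<Rightarrow> 'v \<Rightarrow> real" where
  "log_flow \<tau> x = ln (P \<tau> f x + \<epsilon>) + n * ln \<tau>"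

lemma flow_pos: "\<tau> \<ge> 0 \<Longrightarrow> P \<tau> f x + \<epsilon> > 0"
  using P_nonneg[OF f_dom f_nonneg, of \<tau> x] \<epsilon>_pos by simp

lemma log_flow_has_derivative:
  assumes "\<tau> > 0"
  shows "((\<lambda>\<tau>. log_flow \<tau> x) has_real_derivative
    Lap G (P \<tau> f) x / (P \<tau> f x + \<epsilon>) + n / \<tau>) (at \<tau>)"
  unfolding log_flow_def using assms flow_pos[of \<tau> x]
  by (auto intro!: derivative_eq_intros P_has_derivative[OF f_dom assms])

lemma log_flow_derivative_ge:
  assumes \<tau>: "\<tau> > 0"
  shows "Lap G (P \<tau> f) x / (P \<tau> f x + \<epsilon>) + n / \<tau> \<ge>
    2 * Gam G (\<lambda>y. sqrt (P \<tau> f y + \<epsilon>)) (\<lambda>y. sqrt (P \<tau> f y + \<epsilon>)) x / (P \<tau> f x + \<epsilon>)"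
proof -
  have u: "P \<tau> f x + \<epsilon> > 0" using flow_pos \<tau> by simp
  have "2 * Gam G (\<lambda>y. sqrt (P \<tau> f y + \<epsilon>)) (\<lambda>y. sqrt (P \<tau> f y + \<epsilon>)) x \<le>
      Lap G (P \<tau> f) x + n / \<tau> * (P \<tau> f x + \<epsilon>)"
    using mult_left_mono[OF Li_Yau[OF CDE n_pos f_dom f_nonneg \<epsilon>_pos \<tau>, of x], of 2]
    by (simp add: distrib_left)
  then have "2 * Gam G (\<lambda>y. sqrt (P \<tau> f y + \<epsilon>)) (\<lambda>y. sqrt (P \<tau> f y + \<epsilon>)) x / (P \<tau> f x + \<epsilon>) \<le>
      (Lap G (P \<tau> f) x + n / \<tau> * (P \<tau> f x + \<epsilon>)) / (P \<tau> f x + \<epsilon>)"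
    using u by (intro divide_right_mono) auto
  also have "\<dots> = Lap G (P \<tau> f) x / (P \<tau> f x + \<epsilon>) + n / \<tau>"
    using u by (simp add: add_divide_distrib)
  finally show ?thesis .
qed

lemma log_flow_mono:
  assumes "0 < t" "t \<le> s"
  shows "log_flow t x \<le> log_flow s x"
proof (rule DERIV_nonneg_imp_nondecreasing[OF assms(2)])
  fix \<tau> assume "t \<le> \<tau>"
  with assms have \<tau>: "\<tau> > 0" by simp
  have "0 \<le> 2 * Gam G (\<lambda>y. sqrt (P \<tau> f y + \<epsilon>)) (\<lambda>y. sqrt (P \<tau> f y + \<epsilon>)) x / (P \<tau> f x + \<epsilon>)"
    using Gam_nonneg flow_pos[of \<tau> x] \<tau> by simp
  also note log_flow_derivative_ge[OF \<tau>]
  finally show "\<exists>d. ((\<lambda>\<tau>. log_flow \<tau> x) has_real_derivative d) (at \<tau>) \<and> 0 \<le> d"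
    using log_flow_has_derivative[OF \<tau>] by blast
qed

text \<open>
  Let \<open>D(\<tau>)\<close> be the value at \<open>(t, x)\<close> minus the value at \<open>(\<tau>, y)\<close>. Monotonicity at \<open>x\<close> and \<open>ln r \<le> r - 1\<close> give
  \<open>D \<le> 2 \<psi>\<close> with \<open>\<psi> = \<surd>(u(x) / u(y)) - 1\<close>. The Li--Yau inequality at \<open>y\<close>, with only the edge to \<open>x\<close> retained in
  \<open>\<Gamma>\<close>, gives \<open>D' \<le> - c \<psi>\<^sup>2\<close>. Hence \<open>D' \<le> - c D\<^sup>2 / 4\<close> as long as \<open>D\<close> is positive.
\<close>

lemma log_flow_edge:
  assumes t: "0 < t" "t < s" and edge: "(x, y) \<in> edges G"
  shows "log_flow t x - log_flow s y \<le> 4 * m_max G / (w_min G * (s - t))"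
proof -
  define c where "c = w_min G / m_max G"
  have m_max_pos: "m_max G > 0" using meas_le_m_max[OF meas_bdd, of x] meas_pos[of x] by simp
  have c: "c > 0" using w_min_pos m_max_pos by (simp add: c_def)
  define D where "D \<tau> = log_flow t x - log_flow \<tau> y" for \<tau>
  define D' where "D' \<tau> = - (Lap G (P \<tau> f) y / (P \<tau> f y + \<epsilon>) + n / \<tau>)" for \<tau>
  have yx: "(y, x) \<in> edges G" using edge edges_sym by (simp add: sym_def)
  have c_le: "c \<le> wt G y x / meas G y"
    unfolding c_def using w_min_le[OF yx] meas_le_m_max[OF meas_bdd, of y] meas_pos[of y] w_min_pos
    by (intro frac_le) auto
  have "D s \<le> 1 / ((c / 4) * (s - t))"
  proof (rule Riccati_comparison[where D = D and D' = D', OF t(2)])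
    show "c / 4 > 0" using c by simp
    fix \<tau> assume \<tau>: "t \<le> \<tau>" "\<tau> \<le> s"
    then have \<tau>0: "\<tau> > 0" using t by simp
    define p where "p = sqrt (P \<tau> f x + \<epsilon>)"
    define q where "q = sqrt (P \<tau> f y + \<epsilon>)"
    have pq: "p > 0" "q > 0" "q\<^sup>2 = P \<tau> f y + \<epsilon>" "p\<^sup>2 = P \<tau> f x + \<epsilon>"
      using flow_pos[of \<tau> x] flow_pos[of \<tau> y] \<tau>0 by (simp_all add: p_def q_def)
    show "(D has_real_derivative D' \<tau>) (at \<tau>)"
      unfolding D_def D'_def by (auto intro!: derivative_eq_intros log_flow_has_derivative[OF \<tau>0])
    have "c * (p - q)\<^sup>2 \<le> wt G y x / meas G y * (p - q)\<^sup>2"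
      by (rule mult_right_mono[OF c_le]) simp
    also have "\<dots> \<le> 2 * Gam G (\<lambda>y. sqrt (P \<tau> f y + \<epsilon>)) (\<lambda>y. sqrt (P \<tau> f y + \<epsilon>)) y"
      unfolding p_def q_def by (rule Gam_ge_edge[OF yx])
    finally have "c * (p - q)\<^sup>2 / q\<^sup>2 \<le> - D' \<tau>"
      using log_flow_derivative_ge[OF \<tau>0, of y] divide_right_mono[of "c * (p - q)\<^sup>2" _ "q\<^sup>2"] pq
      unfolding D'_def by (smt (verit) zero_le_power2)
    also have "c * (p - q)\<^sup>2 / q\<^sup>2 = c * (p / q - 1)\<^sup>2"
      using pq by (simp add: power2_eq_square field_simps)
    finally have D'_le: "D' \<tau> \<le> - c * (p / q - 1)\<^sup>2" by simp
    moreover have "- c * (p / q - 1)\<^sup>2 \<le> 0" using c by simp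
    ultimately show "D' \<tau> \<le> 0" by linarith
    assume D_pos: "D \<tau> > 0"
    have "D \<tau> \<le> log_flow \<tau> x - log_flow \<tau> y"
      using log_flow_mono[OF t(1) \<tau>(1), of x] by (simp add: D_def)
    also have "\<dots> = ln (p\<^sup>2) - ln (q\<^sup>2)" using pq by (simp add: log_flow_def)
    also have "\<dots> = 2 * ln (p / q)" using pq(1,2) by (simp add: ln_div ln_realpow)
    also have "\<dots> \<le> 2 * (p / q - 1)" using pq ln_le_minus_one[of "p / q"] by simp
    finally have "D \<tau> / 2 \<le> p / q - 1" by (subst pos_divide_le_eq) (simp_all only: mult.commute zero_less_numeral)
    then have "(D \<tau> / 2)\<^sup>2 \<le> (p / q - 1)\<^sup>2"
      using D_pos by (intro power_mono) simp_all
    then have "c * (D \<tau> / 2)\<^sup>2 \<le> c * (p / q - 1)\<^sup>2" using c by (intro mult_left_mono) auto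
    with D'_le show "D' \<tau> \<le> - (c / 4) * (D \<tau>)\<^sup>2" by (simp add: power_divide)
  qed
  also have "1 / ((c / 4) * (s - t)) = 4 * m_max G / (w_min G * (s - t))"
    using m_max_pos w_min_pos t by (simp add: c_def field_simps)
  finally show ?thesis by (simp add: D_def)
qed

text \<open>
  Each of the \<open>k\<close> edges is crossed in time \<open>(s - t) / k\<close> and costs \<open>C k / (s - t)\<close> with \<open>C = 4 m_max / w_min\<close>.
\<close>

lemma log_flow_path:
  assumes "0 < t" "t < s" "(x, z) \<in> edges G ^^ k"
  shows "log_flow t x - log_flow s z \<le> 4 * m_max G * (real k)\<^sup>2 / (w_min G * (s - t))"
  using assms
proof (induction k arbitrary: s z)
  case 0
  then show ?case using log_flow_mono[of t s x] by simp
next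
  case (Suc k)
  from Suc.prems(3) obtain y where y: "(x, y) \<in> edges G ^^ k" "(y, z) \<in> edges G" by auto
  define C where "C = 4 * m_max G / w_min G"
  define \<delta> where "\<delta> = (s - t) / real (Suc k)"
  have \<delta>: "\<delta> > 0" "s - t = real (Suc k) * \<delta>" using Suc.prems by (simp_all add: \<delta>_def)
  have edge: "log_flow (s - \<delta>) y - log_flow s z \<le> C / \<delta>"
  proof -
    have "s - \<delta> \<ge> t" using \<delta> by (simp add: algebra_simps)
    then show ?thesis using log_flow_edge[of "s - \<delta>" s y z] y(2) \<delta> Suc.prems by (simp add: C_def)
  qed
  have path: "log_flow t x - log_flow (s - \<delta>) y \<le> C * real k / \<delta>"
  \<comment> \<open>The induction hypothesis needs \<open>t < s - \<delta>\<close>, which fails for the first edge; there is nothing to cross then.\<close>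
  proof (cases "k = 0")
    case True
    then have "s - \<delta> = t" using \<delta>(2) by simp
    then show ?thesis using y(1) True by simp
  next
    case False
    have "s - \<delta> - t = real k * \<delta>" using \<delta>(2) by (simp add: algebra_simps)
    moreover have "real k * \<delta> > 0" using False \<delta> by simp
    ultimately have "log_flow t x - log_flow (s - \<delta>) y \<le> 4 * m_max G * (real k)\<^sup>2 / (w_min G * (real k * \<delta>))"
      using Suc.IH[of "s - \<delta>" y] y(1) Suc.prems(1) by simp
    also have "\<dots> = C * real k / \<delta>"
      using False \<delta> w_min_pos by (simp add: C_def power2_eq_square field_simps)
    finally show ?thesis .
  qed
  have "4 * m_max G * (real (Suc k))\<^sup>2 / (w_min G * (s - t)) = C * real (Suc k) / \<delta>"
    unfolding \<delta>(2) using \<delta>(1) w_min_pos by (simp add: C_def power2_eq_square divide_simps)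
  also have "\<dots> = C * real k / \<delta> + C / \<delta>" by (simp add: algebra_simps add_divide_distrib)
  finally show ?case using edge path by linarith
qed

lemma Harnack_shifted:
  assumes t: "0 < t" "t < s"
  shows "P t f x + \<epsilon> \<le> (P s f z + \<epsilon>) * ((s / t) powr n *
    exp (4 * m_max G * (real (graph_dist G x z))\<^sup>2 / (w_min G * (s - t))))"
proof -
  define E where "E = 4 * m_max G * (real (graph_dist G x z))\<^sup>2 / (w_min G * (s - t))"
  have "\<exists>k. (x, z) \<in> edges G ^^ k" using connected rtrancl_power by blast
  then have "(x, z) \<in> edges G ^^ graph_dist G x z" unfolding graph_dist_def by (rule LeastI_ex)
  from log_flow_path[OF t this]
  have "ln (P t f x + \<epsilon>) \<le> ln (P s f z + \<epsilon>) + n * (ln s - ln t) + E"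
    by (simp add: log_flow_def E_def algebra_simps)
  then have "exp (ln (P t f x + \<epsilon>)) \<le> exp (ln (P s f z + \<epsilon>) + n * (ln s - ln t) + E)" by simp
  then show ?thesis
    using t flow_pos[of t x] flow_pos[of s z]
    by (simp add: exp_add powr_def ln_div E_def mult.assoc)
qed

end

context heat_flow
begin

text \<open>
  The constant in the shifted inequality does not depend on \<open>\<epsilon>\<close>, so one may let \<open>\<epsilon>\<close> tend to \<open>0\<close>.
\<close>

lemma Harnack:
  assumes "CDE' G n 0" "n > 0" "f \<in> dom_Lap G" "\<And>x. f x \<ge> 0"
    and "w_min G > 0" "bdd_above (range (meas G))"
    and "0 < t" "t < s"
  shows "P t f x \<le> P s f z * ((s / t) powr n *
    exp (4 * m_max G * (real (graph_dist G x z))\<^sup>2 / (w_min G * (s - t))))"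
proof -
  define A where "A = (s / t) powr n * exp (4 * m_max G * (real (graph_dist G x z))\<^sup>2 / (w_min G * (s - t)))"
  have "P t f x + \<epsilon> \<le> (P s f z + \<epsilon>) * A" if "\<epsilon> > 0" for \<epsilon>
  proof -
    interpret Li_Yau_flow G P n f \<epsilon> by unfold_locales (use assms that in auto)
    show ?thesis unfolding A_def by (rule Harnack_shifted[OF assms(7,8)])
  qed
  then have ev: "\<forall>\<^sub>F \<epsilon> in at_right 0. P t f x + \<epsilon> \<le> (P s f z + \<epsilon>) * A"
    using eventually_at_right_less[of "0 :: real"] by (rule eventually_mono[rotated])
  have lim: "((\<lambda>\<epsilon>. P t f x + \<epsilon>) \<longlongrightarrow> P t f x + 0) (at_right 0)"
    "((\<lambda>\<epsilon>. (P s f z + \<epsilon>) * A) \<longlongrightarrow> (P s f z + 0) * A) (at_right 0)"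
    by (intro tendsto_intros)+
  have "P t f x + 0 \<le> (P s f z + 0) * A"
    by (rule tendsto_le[OF trivial_limit_at_right_real lim(2,1) ev])
  then show ?thesis by (simp add: A_def)
qed

lemma point_mass_C0: "(\<lambda>z. indicator {y} z / meas G y) \<in> C0"
  unfolding C0_def by (auto intro: finite_subset[of _ "{y}"] simp: indicator_def)

lemma heat_kernel_nonneg: "t \<ge> 0 \<Longrightarrow> heat_kernel G P t x y \<ge> 0"
  unfolding heat_kernel_def
  by (rule P_nonneg[OF C0_dom_Lap[OF point_mass_C0]]) (auto simp: meas_nonneg)

text \<open>
  The sum over \<open>F\<close> is the semigroup applied to the indicator function of \<open>F\<close>, which is bounded by \<open>1\<close>.
\<close>

lemma heat_kernel_mass_le_1:
  assumes t: "t \<ge> 0" and F: "finite F"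
  shows "(\<Sum>y\<in>F. heat_kernel G P t x y * meas G y) \<le> 1"
proof -
  let ?b = "\<lambda>y z. meas G y * (indicator {y} z / meas G y)"
  have b_C0: "?b y \<in> C0" for y
    unfolding C0_def by (auto intro: finite_subset[of _ "{y}"] simp: indicator_def)
  have "P t (?b y) x = heat_kernel G P t x y * meas G y" for y
    using P_scale[OF t C0_l2[OF point_mass_C0], of "meas G y" y] by (simp add: heat_kernel_def)
  then have "(\<Sum>y\<in>F. heat_kernel G P t x y * meas G y) = P t (\<lambda>z. \<Sum>y\<in>F. ?b y z) x"
    using P_sum[OF t F, of ?b] b_C0 by simp
  also have "\<dots> \<le> 1"
  proof (rule P_le_const[OF C0_dom_Lap _ _ t])
    show "(\<lambda>z. \<Sum>y\<in>F. ?b y z) \<in> C0" using P_sum[OF t F, of ?b] b_C0 by simp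
    show "(\<Sum>y\<in>F. ?b y z) \<le> 1" for z
    proof -
      have "(\<Sum>y\<in>F. ?b y z) = (\<Sum>y\<in>F. if y = z then 1 else 0)"
        using meas_pos by (intro sum.cong) (auto simp: indicator_def less_imp_neq[symmetric])
      also have "\<dots> \<le> 1" using F by (simp add: sum.delta)
      finally show ?thesis .
    qed
  qed simp
  finally show ?thesis .
qed

text \<open>
  A single term of the sum defining the \<open>\<ell>\<^sup>p\<close> norm already controls the value, as the measure is bounded below.
\<close>

lemma lp_bounded:
  assumes f: "f \<in> lp G p" and p: "1 \<le> p"
  obtains M where "\<And>x. \<bar>f x\<bar> \<le> M"
proof (cases "p = \<infinity>")
  case True
  then have "bounded (range f)" using f by (simp add: lp_def)
  then show ?thesis using that by (auto simp: bounded_iff)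
next
  case False
  define q where "q = real_of_ereal p"
  have q: "q \<ge> 1" using p False by (cases p) (auto simp: q_def)
  have sum: "(\<lambda>x. \<bar>f x\<bar> powr q * meas G x) summable_on UNIV"
    using f False by (simp add: lp_def q_def)
  define S where "S = (\<Sum>\<^sub>\<infinity>x. \<bar>f x\<bar> powr q * meas G x)"
  have "\<bar>f x\<bar> \<le> (S / m_min) powr (1 / q)" for x
  proof -
    have "\<bar>f x\<bar> powr q * m_min \<le> \<bar>f x\<bar> powr q * meas G x"
      by (rule mult_left_mono[OF m_min_le]) simp
    also have "\<dots> \<le> S"
      using finite_sum_le_infsum[OF sum, of "{x}"] meas_nonneg by (simp add: S_def)
    finally have "\<bar>f x\<bar> powr q \<le> S / m_min" using m_min_pos by (simp add: field_simps)
    then have "(\<bar>f x\<bar> powr q) powr (1 / q) \<le> (S / m_min) powr (1 / q)"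
      using q by (intro powr_mono2) auto
    then show ?thesis using q by (simp add: powr_powr)
  qed
  then show ?thesis by (rule that)
qed

lemma heat_ext_summable:
  assumes t: "t \<ge> 0" and f: "\<And>y. f y \<ge> 0" "\<And>y. f y \<le> M"
  shows "(\<lambda>y. heat_kernel G P t x y * f y * meas G y) summable_on UNIV"
proof (rule nonneg_bdd_above_summable_on)
  show "heat_kernel G P t x y * f y * meas G y \<ge> 0" for y
    using heat_kernel_nonneg[OF t] f(1) meas_nonneg by simp
  have "M \<ge> 0" using f order_trans by blast
  have "(\<Sum>y\<in>F. heat_kernel G P t x y * f y * meas G y) \<le> M" if "finite F" for F
  proof -
    have "(\<Sum>y\<in>F. heat_kernel G P t x y * f y * meas G y) \<le>
        (\<Sum>y\<in>F. M * (heat_kernel G P t x y * meas G y))"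
    proof (rule sum_mono)
      fix y
      have "f y * (heat_kernel G P t x y * meas G y) \<le> M * (heat_kernel G P t x y * meas G y)"
        using heat_kernel_nonneg[OF t] meas_nonneg by (intro mult_right_mono f) simp
      then show "heat_kernel G P t x y * f y * meas G y \<le> M * (heat_kernel G P t x y * meas G y)"
        by (simp add: mult_ac)
    qed
    also have "\<dots> \<le> M * 1"
      unfolding sum_distrib_left[symmetric]
      by (rule mult_left_mono[OF heat_kernel_mass_le_1[OF t that] \<open>M \<ge> 0\<close>])
    finally show ?thesis by simp
  qed
  then show "bdd_above (sum (\<lambda>y. heat_kernel G P t x y * f y * meas G y) ` {F. F \<subseteq> UNIV \<and> finite F})"
    by (auto intro!: bdd_aboveI2)
qed

end

theorem corollary1p2:
  fixes G :: "'v wgraph"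
    and P :: "real \<Rightarrow> ('v \<Rightarrow> real) \<Rightarrow> 'v \<Rightarrow> real"
    and n s t :: real and p :: ereal
    and f :: "'v \<Rightarrow> real" and x z :: 'v
  assumes "weighted_graph G"
    and "heat_semigroup G P"
    and "graph_complete G"
    and "nondegenerate G"
    and "w_min G > 0"
    and "bdd_above (range (meas G))"
    and "n > 0"
    and "CDE' G n 0"
    and "0 < t" and "t < s"
    and "1 \<le> p" and "f \<in> lp G p" and "\<And>y. 0 \<le> f y"
  shows "heat_ext G P t f x \<le> heat_ext G P s f z * (s / t) powr n *
           exp (4 * m_max G * (real (graph_dist G x z))\<^sup>2 / (w_min G * (s - t)))"
proof -
  interpret weighted_graph G by fact
  interpret heat_flow G P by unfold_locales fact+
  define A where "A = (s / t) powr n * exp (4 * m_max G * (real (graph_dist G x z))\<^sup>2 / (w_min G * (s - t)))"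
  obtain M where "\<And>y. \<bar>f y\<bar> \<le> M" using lp_bounded[OF assms(12,11)] by blast
  then have M: "f y \<le> M" for y using abs_le_D1 by blast
  have kernel: "heat_kernel G P t x y \<le> heat_kernel G P s z y * A" for y
    unfolding heat_kernel_def A_def
    by (rule Harnack[OF assms(8,7) C0_dom_Lap[OF point_mass_C0] _ assms(5,6,9,10)]) (simp add: meas_nonneg)
  have "heat_ext G P t f x \<le> (\<Sum>\<^sub>\<infinity>y. A * (heat_kernel G P s z y * f y * meas G y))"
    unfolding heat_ext_def
  proof (rule infsum_mono)
    show "(\<lambda>y. heat_kernel G P t x y * f y * meas G y) summable_on UNIV"
      by (rule heat_ext_summable[of t f M]) (use assms M in auto)
    show "(\<lambda>y. A * (heat_kernel G P s z y * f y * meas G y)) summable_on UNIV"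
      by (intro summable_on_cmult_right heat_ext_summable[of s f M]) (use assms M in auto)
    fix y
    have "heat_kernel G P t x y * (f y * meas G y) \<le> heat_kernel G P s z y * A * (f y * meas G y)"
      using assms(13) meas_nonneg by (intro mult_right_mono kernel) simp
    then show "heat_kernel G P t x y * f y * meas G y \<le> A * (heat_kernel G P s z y * f y * meas G y)"
      by (simp add: mult_ac)
  qed
  also have "\<dots> = A * heat_ext G P s f z"
    by (simp add: infsum_cmult_right' heat_ext_def)
  finally show ?thesis by (simp add: A_def mult_ac)
qed

end
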